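(* Let $k\ge 3$ be an integer and $\varepsilon>0$. Then: (i) If $p\ge (1+\varepsilon)\sqrt{(k-1)!\,(\log n)/n^{k}}$, then asymptotically almost surely $H_{n,p}^{(k)}$ is $\mathscr{T}$-connected. (ii) If $p\le (1-\varepsilon)\sqrt{(k-1)!\,(\log n)/n^{k}}$, then asymptotically almost surely $H_{n,p}^{(k)}$ is not $\mathscr{T}$-connected.
   Context: $H_{n,p}^{(k)}$ denotes the random $k$-uniform hypergraph on vertex set $[n]$ in which each possible $k$-element edge appears independently with probability $p$; $\log$ is the natural logarithm; "asymptotically almost surely" means with probability tending to $1$ as $n\to\infty$. For distinct vertices $u,v$ of a $k$-uniform hypergraph $H$, a $1$-offset $uv$-trail is a sequence of edges $E_1,\dots,E_t$ of $H$ (vertices may appear in several of these edges) such that consecutive intersections alternate in size $|E_1\cap E_2|=k-1$, $|E_2\cap E_3|=1$, $|E_3\cap E_4|=k-1$, \dots, ending with $|E_{t-1}\cap E_t|=k-1$ (so $t$ is even), with $u\in E_1\setminus E_2$ and $v\in E_t\setminus E_{t-1}$. $H$ is $\mathscr{T}$-connected if for every pair of distinct vertices $u,v$ there exists a $1$-offset $uv$-trail in $H$. *)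

theory Defs
  imports "HOL-Probability.Probability"
begin

text \<open>
  A hypergraph on a vertex set \<open>V\<close> is given by its edge set \<open>H \<subseteq> Pow V\<close>. Below, each of the
  \<open>k\<close>-element subsets of \<open>{1..n}\<close> is an edge independently with probability \<open>p\<close>.
\<close>

definition possible_edges :: "nat \<Rightarrow> nat \<Rightarrow> nat set set" where
  "possible_edges k n = {e. e \<subseteq> {1..n} \<and> card e = k}"

definition random_hypergraph :: "nat \<Rightarrow> nat \<Rightarrow> real \<Rightarrow> nat set set pmf" where
  "random_hypergraph k n p =
     map_pmf (\<lambda>X. {e \<in> possible_edges k n. X e})
       (Pi_pmf (possible_edges k n) False (\<lambda>_. bernoulli_pmf p))"

text \<open>
  The edges \<open>E\<^sub>1, \<dots>, E\<^sub>t\<close> of a trail are the entries \<open>es ! 0, \<dots>, es ! (t - 1)\<close> of a list, so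
  that \<open>E\<^sub>1 \<inter> E\<^sub>2\<close>, \<open>E\<^sub>3 \<inter> E\<^sub>4\<close>, \dots (of size \<open>k - 1\<close>) start at even list indices. Neither edges nor
  vertices are required to be distinct along the trail.
\<close>

definition one_offset_trail ::
  "nat \<Rightarrow> 'a set set \<Rightarrow> 'a \<Rightarrow> 'a \<Rightarrow> 'a set list \<Rightarrow> bool" where
  "one_offset_trail k H u v es \<longleftrightarrow>
     set es \<subseteq> H \<and> length es \<ge> 2 \<and> even (length es) \<and>
     (\<forall>i. Suc i < length es \<longrightarrow>
        card (es ! i \<inter> es ! Suc i) = (if even i then k - 1 else 1)) \<and>
     u \<in> es ! 0 - es ! 1 \<and>
     v \<in> es ! (length es - 1) - es ! (length es - 2)"

definition T_connected :: "nat \<Rightarrow> 'a set \<Rightarrow> 'a set set \<Rightarrow> bool" where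
  "T_connected k V H \<longleftrightarrow>
     (\<forall>u\<in>V. \<forall>v\<in>V. u \<noteq> v \<longrightarrow> (\<exists>es. one_offset_trail k H u v es))"

end

theory Submission
  imports Defs "HOL-Real_Asymp.Real_Asymp"
begin

text \<open>
  Call \<open>x\<close> and \<open>y\<close> adjacent if some \<open>(k - 1)\<close>-set \<open>S\<close> forms an edge with each of them, so that a trail is a
  walk in this graph whose consecutive steps meet in a single vertex.

  Below the threshold some vertex is isolated. Expose the edges outside a set \<open>U\<close> of
  \<open>n powr (1 - \<epsilon>\<^sup>2)\<close> vertices (up to logarithms). Given their shadow, the events that \<open>u \<in> U\<close>
  forms an edge with no set of the shadow are independent, and each is likely enough that one of
  them occurs. Pairs of edges that share \<open>k - 1\<close> vertices and both meet \<open>U\<close> are too rare to matter.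

  Above the threshold the graph is connected: for a vertex set \<open>A\<close> of size at most \<open>n / 2\<close>, the edges
  outside \<open>A\<close> have a shadow of size about \<open>k\<close> times their number (few edges share a \<open>(k - 1)\<close>-set), and
  no edge consists of a vertex of \<open>A\<close> and a set of the shadow with probability about
  \<open>n powr (- (1 + \<epsilon>) * card A)\<close>, or much smaller when \<open>A\<close> is large. A shortest path in the graph then gives a
  trail after detours at the vertices where consecutive steps meet in more than one vertex. Such
  steps span at most \<open>2 * k\<close> vertices with four edges, so there are only polylogarithmically many of
  them, and each lacks a detour with probability at most a negative power of \<open>n\<close>.
\<close>

text \<open>About \<open>n^k * p / k!\<close> edges have a shadow of about
  \<open>n^k * p / (k - 1)!\<close> sets, so a vertex forms an edge with none of them with
  probability about \<open>exp (- (n^k * p^2 / (k - 1)!))\<close>. This equals \<open>1 / n\<close>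
  at the threshold, and a factor \<open>1 + \<epsilon>\<close> or \<open>1 - \<epsilon>\<close> in
  \<open>p\<close> enters the exponent squared. Two obstacles shape the proof. Adjacency is a
  condition on pairs of edges, so neither the isolation of different vertices nor the absence of
  different pairs across a cut is independent; once the edges on one side are exposed, the pairs
  turn into single unexposed edges. And the size of the shadow is needed in opposite directions:
  below the threshold the trivial upper bound \<open>k * card G\<close> suffices, while above it a
  lower bound must hold for all vertex sets at once. There about \<open>n * log n\<close>
  overlapping pairs of edges compete with a shadow of order \<open>n^(k/2)\<close> up to logarithms,
  and \<open>k \<ge> 3\<close> makes the latter win.\<close>

definition random_subset :: "'a set \<Rightarrow> real \<Rightarrow> 'a set pmf" where
  "random_subset D p =
     map_pmf (\<lambda>X. {e \<in> D. X e}) (Pi_pmf D False (\<lambda>_. bernoulli_pmf p))"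

abbreviation rprob :: "'a set \<Rightarrow> real \<Rightarrow> ('a set \<Rightarrow> bool) \<Rightarrow> real" where
  "rprob D p Q \<equiv> measure_pmf.prob (random_subset D p) {H. Q H}"

lemma random_hypergraph_eq: "random_hypergraph k n p = random_subset (possible_edges k n) p"
  by (simp add: random_hypergraph_def random_subset_def)

lemma random_subset_empty [simp]: "random_subset {} p = return_pmf {}"
  by (simp add: random_subset_def)

lemma set_pmf_random_subset: "set_pmf (random_subset D p) \<subseteq> Pow D"
  by (auto simp: random_subset_def)

lemma finite_set_pmf_random_subset: "finite D \<Longrightarrow> finite (set_pmf (random_subset D p))"
  by (meson finite_Pow_iff finite_subset set_pmf_random_subset)

section \<open>Independence over disjoint sets of edges, and exposure in two rounds\<close>

lemma random_subset_union:
  assumes "finite A" "finite B" "A \<inter> B = {}"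
  shows "random_subset (A \<union> B) p =
           map_pmf (\<lambda>(X, Y). X \<union> Y) (pair_pmf (random_subset A p) (random_subset B p))"
proof -
  let ?q = "\<lambda>_. bernoulli_pmf p"
  have "random_subset (A \<union> B) p =
      map_pmf (\<lambda>(f, g). {e \<in> A \<union> B. if e \<in> A then f e else g e})
        (pair_pmf (Pi_pmf A False ?q) (Pi_pmf B False ?q))"
    using assms by (simp add: random_subset_def Pi_pmf_union pmf.map_comp o_def case_prod_unfold)
  also have "(\<lambda>(f, g). {e \<in> A \<union> B. if e \<in> A then f e else g e}) =
      (\<lambda>(X, Y). X \<union> Y) \<circ> (\<lambda>(f, g). ({e \<in> A. f e}, {e \<in> B. g e}))"
    using assms(3) by (auto simp: fun_eq_iff)
  also have "map_pmf \<dots> (pair_pmf (Pi_pmf A False ?q) (Pi_pmf B False ?q)) =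
      map_pmf (\<lambda>(X, Y). X \<union> Y) (pair_pmf (random_subset A p) (random_subset B p))"
    unfolding pmf.map_comp[symmetric] random_subset_def map_pair by simp
  finally show ?thesis .
qed

lemma random_subset_singleton:
  "random_subset {x} p = map_pmf (\<lambda>b. if b then {x} else {}) (bernoulli_pmf p)"
  unfolding random_subset_def Pi_pmf_singleton pmf.map_comp
  by (intro map_pmf_cong) auto

lemma random_subset_insert:
  assumes "finite D" "x \<notin> D"
  shows "random_subset (insert x D) p =
           bernoulli_pmf p \<bind> (\<lambda>b. map_pmf (\<lambda>X. if b then insert x X else X) (random_subset D p))"
proof -
  have "random_subset (insert x D) p = random_subset ({x} \<union> D) p" by simp
  also have "\<dots> = map_pmf (\<lambda>(X, Y). X \<union> Y) (pair_pmf (random_subset {x} p) (random_subset D p))"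
    using assms by (intro random_subset_union) auto
  also have "\<dots> = bernoulli_pmf p \<bind> (\<lambda>b. map_pmf (\<lambda>X. if b then insert x X else X) (random_subset D p))"
    by (auto simp: random_subset_singleton pair_pmf_def map_pmf_def bind_assoc_pmf bind_return_pmf
             intro!: bind_pmf_cong)
  finally show ?thesis .
qed

lemma rprob_mono:
  assumes "\<And>H. H \<subseteq> D \<Longrightarrow> Q H \<Longrightarrow> R H"
  shows "rprob D p Q \<le> rprob D p R"

  by (rule measure_pmf.finite_measure_mono_AE)
     (use assms set_pmf_random_subset[of D p] in \<open>auto simp: AE_measure_pmf_iff\<close>)

lemma rprob_cong:
  assumes "\<And>H. H \<subseteq> D \<Longrightarrow> Q H \<longleftrightarrow> R H"
  shows "rprob D p Q = rprob D p R"
  using assms by (intro antisym rprob_mono) auto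

lemma rprob_not: "rprob D p (\<lambda>H. \<not> Q H) = 1 - rprob D p Q"
  using measure_pmf.prob_compl[of "{H. Q H}" "random_subset D p"]
  by (simp add: Compl_eq_Diff_UNIV[symmetric] Collect_neg_eq)

lemma rprob_Un_le: "rprob D p (\<lambda>H. Q H \<or> R H) \<le> rprob D p Q + rprob D p R"
  unfolding Collect_disj_eq by (rule measure_Un_le) auto

lemma rprob_ex_le:
  assumes "finite I"
  shows "rprob D p (\<lambda>H. \<exists>i\<in>I. Q i H) \<le> (\<Sum>i\<in>I. rprob D p (Q i))"
proof -
  have "{H. \<exists>i\<in>I. Q i H} = (\<Union>i\<in>I. {H. Q i H})" by auto
  with measure_pmf.finite_measure_subadditive_finite[OF assms, of "\<lambda>i. {H. Q i H}" "random_subset D p"]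
  show ?thesis by auto
qed

text \<open>Fubini for exposure in two rounds. \<open>Q\<close> may couple the halves arbitrarily,
  so what is asked of the second half can depend on the outcome of the first.\<close>

lemma rprob_pair:
  assumes "finite A" "finite B" "A \<inter> B = {}"
  shows "rprob (A \<union> B) p (\<lambda>H. Q (H \<inter> A) (H \<inter> B)) =
           measure_pmf.expectation (random_subset A p) (\<lambda>X. rprob B p (Q X))"
proof -
  let ?M = "pair_pmf (random_subset A p) (random_subset B p)"
  have "rprob (A \<union> B) p (\<lambda>H. Q (H \<inter> A) (H \<inter> B)) =
      measure_pmf.prob ?M {z. Q ((fst z \<union> snd z) \<inter> A) ((fst z \<union> snd z) \<inter> B)}"
    by (simp add: random_subset_union[OF assms] case_prod_unfold vimage_def)
  also have "\<dots> = measure_pmf.prob ?M {z. Q (fst z) (snd z)}"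
  proof (intro measure_pmf.finite_measure_eq_AE)
    have "(X \<union> Y) \<inter> A = X \<and> (X \<union> Y) \<inter> B = Y" 
      if "X \<in> set_pmf (random_subset A p)" "Y \<in> set_pmf (random_subset B p)" for X Y
      using that assms(3) set_pmf_random_subset[of A p] set_pmf_random_subset[of B p] by blast
    then show "AE z in measure_pmf ?M. (z \<in> {z. Q ((fst z \<union> snd z) \<inter> A) ((fst z \<union> snd z) \<inter> B)})
       = (z \<in> {z. Q (fst z) (snd z)})"
      by (auto simp: AE_measure_pmf_iff)
  qed auto
  also have "\<dots> = measure_pmf.expectation (random_subset A p) (\<lambda>X. rprob B p (Q X))"
  proof -
    have "ennreal (measure_pmf.prob ?M {z. Q (fst z) (snd z)}) =
        (\<integral>\<^sup>+X. ennreal (rprob B p (Q X)) \<partial>random_subset A p)"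
      unfolding measure_pmf.emeasure_eq_measure[symmetric] pair_pmf_def
      by (simp add: map_pmf_def[symmetric] vimage_def)
    also have "\<dots> = ennreal (measure_pmf.expectation (random_subset A p) (\<lambda>X. rprob B p (Q X)))"
      by (intro nn_integral_eq_integral integrable_measure_pmf_finite
            finite_set_pmf_random_subset assms) auto
    finally show ?thesis by (simp add: integral_nonneg_AE)
  qed
  finally show ?thesis .
qed

lemma integrable_random_subset [simp]:
  fixes f :: "'a set \<Rightarrow> real"
  assumes "finite D"
  shows "integrable (measure_pmf (random_subset D p)) f"
  by (intro integrable_measure_pmf_finite finite_set_pmf_random_subset assms)

lemma rprob_cond_le:
  assumes "finite A" "finite B" "A \<inter> B = {}"
    and "\<And>X. X \<subseteq> A \<Longrightarrow> rprob B p (Q X) \<le> c"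
  shows "rprob (A \<union> B) p (\<lambda>H. Q (H \<inter> A) (H \<inter> B)) \<le> c"
proof -
  have "rprob (A \<union> B) p (\<lambda>H. Q (H \<inter> A) (H \<inter> B)) \<le> measure_pmf.expectation (random_subset A p) (\<lambda>_. c)"
    unfolding rprob_pair[OF assms(1-3)]
    using assms set_pmf_random_subset[of A p]
    by (intro integral_mono_AE) (auto simp: AE_measure_pmf_iff)
  then show ?thesis by simp
qed

lemma rprob_indep2:
  assumes "finite A" "finite B" "A \<inter> B = {}"
  shows "rprob (A \<union> B) p (\<lambda>H. Q (H \<inter> A) \<and> R (H \<inter> B)) = rprob A p Q * rprob B p R"
proof -
  have "rprob (A \<union> B) p (\<lambda>H. Q (H \<inter> A) \<and> R (H \<inter> B)) =
     measure_pmf.expectation (random_subset A p) (\<lambda>X. rprob B p (\<lambda>Y. Q X \<and> R Y))"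
    using rprob_pair[OF assms, of p "\<lambda>X Y. Q X \<and> R Y"] .
  also have "(\<lambda>X. rprob B p (\<lambda>Y. Q X \<and> R Y)) = (\<lambda>X. indicator {X. Q X} X * rprob B p R)"
    by (auto simp: fun_eq_iff indicator_def)
  also have "measure_pmf.expectation (random_subset A p) \<dots> = rprob A p Q * rprob B p R"
    using assms by simp
  finally show ?thesis .
qed

lemma rprob_restrict:
  assumes "finite D" "A \<subseteq> D"
  shows "rprob D p (\<lambda>H. Q (H \<inter> A)) = rprob A p Q"
proof -
  have D: "A \<union> (D - A) = D" using assms by auto
  have "rprob (A \<union> (D - A)) p (\<lambda>H. Q (H \<inter> A) \<and> True) = rprob A p Q * rprob (D - A) p (\<lambda>_. True)"
    using assms by (intro rprob_indep2) (auto intro: finite_subset)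
  then show ?thesis unfolding D by simp
qed

lemma rprob_indep2':
  assumes "finite D" "A \<subseteq> D" "B \<subseteq> D" "A \<inter> B = {}"
  shows "rprob D p (\<lambda>H. Q (H \<inter> A) \<and> R (H \<inter> B)) =
           rprob D p (\<lambda>H. Q (H \<inter> A)) * rprob D p (\<lambda>H. R (H \<inter> B))"
proof -
  have fin: "finite A" "finite B" using assms finite_subset by metis+
  have "rprob D p (\<lambda>H. Q (H \<inter> A) \<and> R (H \<inter> B)) = rprob (A \<union> B) p (\<lambda>H. Q (H \<inter> A) \<and> R (H \<inter> B))"
    using rprob_restrict[of D "A \<union> B" p "\<lambda>H. Q (H \<inter> A) \<and> R (H \<inter> B)"] assms
    by (simp add: Int_assoc Int_absorb1)
  with assms fin show ?thesis by (simp add: rprob_indep2 rprob_restrict)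
qed

lemma rprob_indep_family:
  assumes "finite D" "finite I" "\<And>i. i \<in> I \<Longrightarrow> A i \<subseteq> D" "disjoint_family_on A I"
  shows "rprob D p (\<lambda>H. \<forall>i\<in>I. Q i (H \<inter> A i)) = (\<Prod>i\<in>I. rprob D p (\<lambda>H. Q i (H \<inter> A i)))"
  using assms(2-4)
proof (induction I rule: finite_induct)
  case empty
  then show ?case by simp
next
  case (insert j I)
  let ?B = "\<Union>i\<in>I. A i"
  have disj: "A j \<inter> ?B = {}"
    using insert.prems(2) insert.hyps(2) by (auto simp: disjoint_family_on_def)
  have *: "H \<inter> ?B \<inter> A i = H \<inter> A i" if "i \<in> I" for H i using that by auto
  have "rprob D p (\<lambda>H. \<forall>i\<in>insert j I. Q i (H \<inter> A i)) =
        rprob D p (\<lambda>H. Q j (H \<inter> A j) \<and> (\<forall>i\<in>I. Q i ((H \<inter> ?B) \<inter> A i)))"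
    by (simp add: *)
  also have "\<dots> = rprob D p (\<lambda>H. Q j (H \<inter> A j)) * rprob D p (\<lambda>H. \<forall>i\<in>I. Q i ((H \<inter> ?B) \<inter> A i))"
    using insert.prems disj
    by (intro rprob_indep2'[where R = "\<lambda>X. \<forall>i\<in>I. Q i (X \<inter> A i)"] assms(1)) auto
  also have "rprob D p (\<lambda>H. \<forall>i\<in>I. Q i ((H \<inter> ?B) \<inter> A i)) = rprob D p (\<lambda>H. \<forall>i\<in>I. Q i (H \<inter> A i))"
    by (simp add: *)
  also have "\<dots> = (\<Prod>i\<in>I. rprob D p (\<lambda>H. Q i (H \<inter> A i)))"
    using insert.prems by (intro insert.IH) (auto simp: disjoint_family_on_def)
  finally show ?case using insert.hyps by simp
qed

lemma rprob_superset:
  assumes "finite D" "E \<subseteq> D" "0 \<le> p" "p \<le> 1"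
  shows "rprob D p (\<lambda>H. E \<subseteq> H) = p ^ card E"
proof -
  have E: "finite E" using assms finite_subset by auto
  have "rprob D p (\<lambda>H. E \<subseteq> H) = rprob D p (\<lambda>H. \<forall>e\<in>E. e \<in> H \<inter> {e})"
    by (intro rprob_cong) auto
  also have "\<dots> = (\<Prod>e\<in>E. rprob D p (\<lambda>H. e \<in> H \<inter> {e}))"
    using E assms by (intro rprob_indep_family) (auto simp: disjoint_family_on_def)
  also have "\<dots> = (\<Prod>e\<in>E. p)"
  proof (intro prod.cong refl)
    fix e assume "e \<in> E"
    then have "rprob D p (\<lambda>H. e \<in> H \<inter> {e}) = rprob {e} p (\<lambda>H. e \<in> H)"
      using assms by (intro rprob_restrict) auto
    also have "\<dots> = measure_pmf.prob (bernoulli_pmf p) {True}"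
      by (auto simp: random_subset_singleton intro!: arg_cong[where f = "measure_pmf.prob _"])
    finally show "rprob D p (\<lambda>H. e \<in> H \<inter> {e}) = p"
      using assms by (simp add: measure_pmf_single)
  qed
  finally show ?thesis by simp
qed

lemma rprob_disjnt:
  assumes "finite D" "E \<subseteq> D" "0 \<le> p" "p \<le> 1"
  shows "rprob D p (\<lambda>H. H \<inter> E = {}) = (1 - p) ^ card E"
proof -
  have E: "finite E" using assms finite_subset by auto
  have "rprob D p (\<lambda>H. H \<inter> E = {}) = rprob D p (\<lambda>H. \<forall>e\<in>E. e \<notin> H \<inter> {e})"
    by (intro rprob_cong) auto
  also have "\<dots> = (\<Prod>e\<in>E. rprob D p (\<lambda>H. e \<notin> H \<inter> {e}))"
    using E assms by (intro rprob_indep_family) (auto simp: disjoint_family_on_def)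
  also have "\<dots> = (\<Prod>e\<in>E. 1 - p)"
  proof (intro prod.cong refl)
    fix e assume "e \<in> E"
    then have "rprob D p (\<lambda>H. e \<notin> H \<inter> {e}) = rprob {e} p (\<lambda>H. e \<notin> H)"
      using assms by (intro rprob_restrict) auto
    also have "\<dots> = measure_pmf.prob (bernoulli_pmf p) {False}"
      by (auto simp: random_subset_singleton intro!: arg_cong[where f = "measure_pmf.prob _"])
    finally show "rprob D p (\<lambda>H. e \<notin> H \<inter> {e}) = 1 - p"
      using assms by (simp add: measure_pmf_single)
  qed
  finally show ?thesis by simp
qed

section \<open>Exponential moments, monotonicity in the edge probability, Markov's
  inequality\<close>

lemma expectation_exp_card:
  assumes "finite D" "0 \<le> p" "p \<le> 1"
  shows "measure_pmf.expectation (random_subset D p) (\<lambda>H. exp (t * real (card H))) =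
           (1 - p + p * exp t) ^ card D"
  using assms(1)
proof (induction D rule: finite_induct)
  case empty
  then show ?case by simp
next
  case (insert x D)
  let ?E = "measure_pmf.expectation (random_subset D p)"
  have card: "card (insert x X) = Suc (card X)" if "X \<in> set_pmf (random_subset D p)" for X
    using that set_pmf_random_subset[of D p] insert.hyps
    by (meson PowD card_insert_disjoint rev_finite_subset subset_iff)
  have "measure_pmf.expectation (random_subset (insert x D) p) (\<lambda>H. exp (t * real (card H))) =
      p * ?E (\<lambda>X. exp (t * real (card (insert x X)))) + (1 - p) * ?E (\<lambda>X. exp (t * real (card X)))"
    unfolding random_subset_insert[OF insert.hyps]
    using insert.hyps assms
    by (subst pmf_expectation_bind[where A = UNIV])
       (auto simp: finite_set_pmf_random_subset UNIV_bool)
  also have "?E (\<lambda>X. exp (t * real (card (insert x X)))) = ?E (\<lambda>X. exp t * exp (t * real (card X)))"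
    by (intro integral_cong_AE) (auto simp: AE_measure_pmf_iff card exp_add[symmetric] algebra_simps)
  finally show ?case using insert by (simp add: algebra_simps)
qed

text \<open>Induction over the ground set in place of a coupling: conditioning on \<open>x\<close>
  gives a convex combination of two probabilities of monotone events, and the weight of the larger
  one grows with \<open>p\<close>.\<close>

lemma rprob_mono_p:
  assumes "finite D" "0 \<le> p" "p \<le> p'" "p' \<le> 1"
    and "\<And>X Y. X \<subseteq> Y \<Longrightarrow> Q X \<Longrightarrow> Q Y"
  shows "rprob D p Q \<le> rprob D p' Q"
  using assms(1,5)
proof (induction D arbitrary: Q rule: finite_induct)
  case empty
  then show ?case by simp
next
  case (insert x D)
  have step: "rprob (insert x D) r Q = r * rprob D r (\<lambda>X. Q (insert x X)) + (1 - r) * rprob D r Q"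
    if "0 \<le> r" "r \<le> 1" for r
  proof -
    have ind: "indicat_real (Collect Q) (insert x X) = indicat_real {X. Q (insert x X)} X" for X
      by (simp add: indicator_def)
    have "rprob (insert x D) r Q = measure_pmf.expectation (random_subset (insert x D) r) (indicator {H. Q H})"
      by simp
    also have "\<dots> = r * rprob D r (\<lambda>X. Q (insert x X)) + (1 - r) * rprob D r Q"
      unfolding random_subset_insert[OF insert.hyps]
      using insert.hyps that
      by (subst pmf_expectation_bind[where A = UNIV])
         (auto simp: finite_set_pmf_random_subset UNIV_bool ind)
    finally show ?thesis .
  qed
  let ?Q = "\<lambda>X. Q (insert x X)"
  have 1: "rprob D p Q \<le> rprob D p' Q" "rprob D p ?Q \<le> rprob D p' ?Q"
  proof -
    show "rprob D p Q \<le> rprob D p' Q" by (intro insert.IH) (rule insert.prems)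
    show "rprob D p ?Q \<le> rprob D p' ?Q"
    proof (intro insert.IH)
      fix X Y assume "X \<subseteq> Y" "Q (insert x X)"
      then show "Q (insert x Y)" using insert.prems[of "insert x X" "insert x Y"] by blast
    qed
  qed
  have 2: "rprob D p Q \<le> rprob D p ?Q"
    using insert.prems by (intro rprob_mono) blast
  have "rprob (insert x D) p Q = rprob D p Q + p * (rprob D p ?Q - rprob D p Q)"
    using assms by (subst step) (auto simp: algebra_simps)
  also have "\<dots> \<le> rprob D p Q + p' * (rprob D p ?Q - rprob D p Q)"
    using 2 assms by (intro add_left_mono mult_right_mono) auto
  also have "\<dots> = p' * rprob D p ?Q + (1 - p') * rprob D p Q" by (simp add: algebra_simps)
  also have "\<dots> \<le> p' * rprob D p' ?Q + (1 - p') * rprob D p' Q"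
    using 1 assms by (intro add_mono mult_left_mono) auto
  also have "\<dots> = rprob (insert x D) p' Q"
    using assms by (subst step) auto
  finally show ?case .
qed

lemma rprob_card_ge_le:
  assumes "finite D" "finite I" "M > 0"
  shows "rprob D p (\<lambda>H. real (card {i\<in>I. Q i H}) \<ge> M) \<le> (\<Sum>i\<in>I. rprob D p (Q i)) / M"
proof -
  let ?f = "\<lambda>H. real (card {i\<in>I. Q i H})"
  have eq: "?f H = (\<Sum>i\<in>I. indicator {H. Q i H} H)" for H
    using assms(2) by (simp add: indicator_def sum.If_cases Int_def)
  have "rprob D p (\<lambda>H. M \<le> ?f H) \<le> measure_pmf.expectation (random_subset D p) ?f / M"
    using integral_Markov_inequality_measure[of "random_subset D p" ?f "{}" M] assms by simp
  also have "measure_pmf.expectation (random_subset D p) ?f = (\<Sum>i\<in>I. rprob D p (Q i))"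
    unfolding eq using assms(1) by (subst Bochner_Integration.integral_sum) auto
  finally show ?thesis .
qed

section \<open>Adjacency, trails and cuts\<close>

definition adj :: "'a set set \<Rightarrow> 'a \<Rightarrow> 'a \<Rightarrow> bool" where
  "adj H x y \<longleftrightarrow> x \<noteq> y \<and> (\<exists>S. x \<notin> S \<and> y \<notin> S \<and> insert x S \<in> H \<and> insert y S \<in> H)"

definition shadow :: "'a set set \<Rightarrow> 'a set set" where
  "shadow G = {S. \<exists>y. y \<notin> S \<and> insert y S \<in> G}"

lemma adj_sym: "adj H x y \<Longrightarrow> adj H y x"
  by (auto simp: adj_def)

lemma T_connected_mono: "T_connected k V H \<Longrightarrow> H \<subseteq> H' \<Longrightarrow> T_connected k V H'"
  unfolding T_connected_def one_offset_trail_def by (meson order.trans)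

text \<open>Only the first two edges matter: each has \<open>k\<close> vertices, they share
  \<open>k - 1\<close>, and so each adds a single vertex to the common set.\<close>

lemma trail_imp_adj:
  assumes "one_offset_trail k H u v es" "\<And>e. e \<in> H \<Longrightarrow> finite e \<and> card e = k" "k > 0"
  shows "\<exists>y. adj H u y"
proof -
  let ?E = "es ! 0" and ?F = "es ! 1"
  have EF: "?E \<in> H" "?F \<in> H" "u \<in> ?E - ?F"
    using assms(1) nth_mem[of 0 es] nth_mem[of 1 es] unfolding one_offset_trail_def by force+
  have c: "card (?E \<inter> ?F) = k - 1"
  proof -
    have "Suc 0 < length es \<longrightarrow> card (es ! 0 \<inter> es ! Suc 0) = (if even (0::nat) then k - 1 else 1)"
      using assms(1) unfolding one_offset_trail_def by blast
    then show ?thesis using assms(1) by (auto simp: one_offset_trail_def)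
  qed
  define S where "S = ?E \<inter> ?F"
  have fin: "finite ?E" "finite ?F" "card ?E = k" "card ?F = k" using EF assms(2) by auto
  have "card (?F - S) = 1"
    using fin c assms(3) by (simp add: card_Diff_subset S_def)
  then obtain y where y: "?F - S = {y}" by (auto simp: card_1_singleton_iff)
  have "card (?E - S) = 1"
    using fin c assms(3) by (simp add: card_Diff_subset S_def)
  then obtain x where x: "?E - S = {x}" by (auto simp: card_1_singleton_iff)
  have "x = u" using x EF by (auto simp: S_def)
  then have "insert u S = ?E" "insert y S = ?F" "u \<notin> S" "y \<notin> S" "u \<noteq> y"
    using x y EF by (auto simp: S_def)
  then show ?thesis unfolding adj_def using EF by metis
qed

text \<open>A trail has even length, so the junction with the appended pair falls on an odd index,
  where the intersection must have size 1, and the pair itself on an even one.\<close>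

lemma one_offset_trail_append:
  assumes "one_offset_trail k H u w es" "F \<in> H" "F' \<in> H" "card (F \<inter> F') = k - 1"
    and "card (last es \<inter> F) = 1" "v \<in> F' - F"
  shows "one_offset_trail k H u v (es @ [F, F'])"
proof -
  let ?n = "length es"
  have n: "?n \<ge> 2" "even ?n" using assms(1) by (auto simp: one_offset_trail_def)
  have last: "last es = es ! (?n - 1)" using n by (subst last_conv_nth) auto
  have inter: "card ((es @ [F, F']) ! i \<inter> (es @ [F, F']) ! Suc i) = (if even i then k - 1 else 1)"
    if i: "Suc i < ?n + 2" for i
  proof -
    consider "Suc i < ?n" | "Suc i = ?n" | "i = ?n" using i by linarith
    then show ?thesis
    proof cases
      case 1
      then show ?thesis using assms(1) by (auto simp: one_offset_trail_def nth_append)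
    next
      case 2
      then have "i = ?n - 1" "odd i" using n by (auto simp flip: even_Suc)
      then show ?thesis using 2 assms(5) last by (auto simp: nth_append)
    next
      case 3
      then show ?thesis using n assms(4) by (simp add: nth_append)
    qed
  qed
  have "u \<in> es ! 0 - es ! 1" "set es \<subseteq> H" using assms(1) by (auto simp: one_offset_trail_def)
  then show ?thesis
    using n inter assms(2,3,6) by (auto simp: one_offset_trail_def nth_append)
qed

text \<open>Consecutive steps of a shortest path in the adjacency relation use distinct edges at
  their common vertex \<open>x\<close>. When these two edges share more than \<open>x\<close>, a further pair of edges
  through \<open>x\<close> is inserted between them.\<close>

lemma T_connectedI:
  assumes unif: "\<And>e. e \<in> H \<Longrightarrow> finite e \<and> card e = k" and "k > 0"
    and path: "\<And>u v. u \<in> V \<Longrightarrow> v \<in> V \<Longrightarrow> (adj H)\<^sup>*\<^sup>* u v"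
    and detour: "\<And>u x v S S'. u \<noteq> x \<Longrightarrow> x \<noteq> v \<Longrightarrow> u \<noteq> v \<Longrightarrow> u \<notin> S \<Longrightarrow> x \<notin> S \<Longrightarrow> x \<notin> S' \<Longrightarrow> v \<notin> S' \<Longrightarrow>
        S \<noteq> S' \<Longrightarrow> S \<inter> S' \<noteq> {} \<Longrightarrow>
        insert u S \<in> H \<Longrightarrow> insert x S \<in> H \<Longrightarrow> insert x S' \<in> H \<Longrightarrow> insert v S' \<in> H \<Longrightarrow>
        \<exists>T a b. a \<noteq> b \<and> a \<notin> T \<and> b \<notin> T \<and> insert a T \<in> H \<and> insert b T \<in> H \<and>
          insert a T \<inter> insert x S = {x} \<and> insert b T \<inter> insert x S' = {x}"
  shows "T_connected k V H"
proof -
  have cardS: "card S = k - 1" "finite S" if "insert x S \<in> H" "x \<notin> S" for x S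
    using unif[OF that(1)] that(2) by (auto simp: card_insert_if)
  \<comment> \<open>The trail is built along a shortest walk. The induction also remembers the last
    set \<open>S\<close> and the vertex \<open>w\<close> before \<open>v\<close>, because the next
    junction depends on \<open>S\<close> and the minimality argument on \<open>w\<close>.\<close>
  have main: "\<exists>es w S. one_offset_trail k H u v es \<and> last es = insert v S \<and> v \<notin> S \<and> w \<notin> S \<and>
      insert w S \<in> H \<and> insert v S \<in> H \<and> w \<noteq> v \<and> (adj H ^^ d) u w"
    if "(adj H ^^ Suc d) u v" "\<And>j. j < Suc d \<Longrightarrow> \<not> (adj H ^^ j) u v" for u v d
    using that
  proof (induction d arbitrary: v)
    case 0
    then have "adj H u v" by auto
    then obtain S where S: "u \<noteq> v" "u \<notin> S" "v \<notin> S" "insert u S \<in> H" "insert v S \<in> H"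
      by (auto simp: adj_def)
    have "insert u S \<inter> insert v S = S" using S by auto
    then have "one_offset_trail k H u v [insert u S, insert v S]"
      using S cardS[OF S(4,2)] by (auto simp: one_offset_trail_def less_Suc_eq nth_Cons')
    then show ?case using S
      by (intro exI[of _ "[insert u S, insert v S]"] exI[of _ u] exI[of _ S]) auto
  next
    case (Suc d)
    from Suc.prems(1) obtain x where x: "(adj H ^^ Suc d) u x" "adj H x v" by auto
    have min: "\<not> (adj H ^^ j) u x" if "j < Suc d" for j
    proof
      assume "(adj H ^^ j) u x"
      then have "(adj H ^^ Suc j) u v" using x(2) by auto
      then show False using Suc.prems(2)[of "Suc j"] that by auto
    qed
    from Suc.IH[OF x(1) min] obtain es w S where es: "one_offset_trail k H u x es"
      "last es = insert x S" "x \<notin> S" "w \<notin> S" "insert w S \<in> H" "insert x S \<in> H" "w \<noteq> x"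
      "(adj H ^^ d) u w" by blast
    have wv: "w \<noteq> v" using Suc.prems(2)[of d] es(8) by auto
    from x(2) obtain S' where S': "x \<noteq> v" "x \<notin> S'" "v \<notin> S'" "insert x S' \<in> H" "insert v S' \<in> H"
      by (auto simp: adj_def)
    \<comment> \<open>If both steps used the same set, \<open>w\<close> and \<open>v\<close> would
      be adjacent through it and the walk could be shortened by one step.\<close>
    have "S \<noteq> S'"
    proof
      assume "S = S'"
      then have "adj H w v" using wv es S' by (auto simp: adj_def)
      then have "(adj H ^^ Suc d) u v" using es(8) by auto
      then show False using Suc.prems(2)[of "Suc d"] by auto
    qed
    have "insert x S' \<inter> insert v S' = S'" using S' by auto
    then have c: "card (insert x S' \<inter> insert v S') = k - 1" using cardS[OF S'(4,2)] by simp
    have "\<exists>es'. one_offset_trail k H u v (es' @ [insert x S', insert v S'])"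
    proof (cases "S \<inter> S' = {}")
      case True
      then have "last es \<inter> insert x S' = {x}" using es S' by auto
      then show ?thesis
        using one_offset_trail_append[OF es(1) S'(4,5) c, of v] S' by auto
    next
      case False
      from detour[OF es(7) S'(1) wv es(4,3) S'(2,3) \<open>S \<noteq> S'\<close> False es(5,6) S'(4,5)]
      obtain T a b where T: "a \<noteq> b" "a \<notin> T" "b \<notin> T" "insert a T \<in> H" "insert b T \<in> H"
        "insert a T \<inter> insert x S = {x}" "insert b T \<inter> insert x S' = {x}" by blast
      have "insert a T \<inter> insert b T = T" using T by auto
      then have "card (insert a T \<inter> insert b T) = k - 1" using cardS[OF T(4,2)] by simp
      moreover have "last es \<inter> insert a T = {x}" using es(2) T(6) by (simp add: Int_commute)
      \<comment> \<open>This trail ends at \<open>b\<close>, but the continuation need not start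
        there: \<open>x\<close> lies in \<open>T\<close>, and the next edge
        \<open>insert x S'\<close> meets \<open>insert b T\<close> in \<open>x\<close> alone, which
        is all that a junction requires.\<close>
      ultimately have "one_offset_trail k H u b (es @ [insert a T, insert b T])"
        using one_offset_trail_append[OF es(1) T(4,5), of b] T by auto
      from one_offset_trail_append[OF this S'(4,5) c, of v] T(7) S'
      have "one_offset_trail k H u v ((es @ [insert a T, insert b T]) @ [insert x S', insert v S'])"
        by auto
      then show ?thesis by blast
    qed
    then obtain es' where "one_offset_trail k H u v (es' @ [insert x S', insert v S'])" by blast
    then show ?case using S' x(1)
      by (intro exI[of _ "es' @ [insert x S', insert v S']"] exI[of _ x] exI[of _ S']) auto
  qed
  show ?thesis unfolding T_connected_def
  proof (intro ballI impI)
    fix u v assume uv: "u \<in> V" "v \<in> V" "u \<noteq> v"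
    then have "\<exists>d. (adj H ^^ d) u v" using path rtranclp_imp_relpowp by fast
    then obtain d where d: "(adj H ^^ d) u v" "\<And>j. j < d \<Longrightarrow> \<not> (adj H ^^ j) u v"
      using exists_least_iff[of "\<lambda>d. (adj H ^^ d) u v"] by blast
    then obtain d' where "d = Suc d'" using uv by (cases d) auto
    then show "\<exists>es. one_offset_trail k H u v es" using main[of d' u v] d by blast
  qed
qed

text \<open>The smaller of a component and its complement. Half of the vertices then lie outside
  \<open>A\<close>, enough for many edges to avoid \<open>A\<close>.\<close>

lemma not_connected_imp_cut:
  assumes "finite V" "\<not> (\<forall>u\<in>V. \<forall>v\<in>V. R\<^sup>*\<^sup>* u v)" and sym: "\<And>x y. R x y \<Longrightarrow> R y x"
  shows "\<exists>A. A \<subseteq> V \<and> A \<noteq> {} \<and> 2 * card A \<le> card V \<and> (\<forall>x\<in>A. \<forall>y\<in>V - A. \<not> R x y)"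
proof -
  from assms(2) obtain u v where uv: "u \<in> V" "v \<in> V" "\<not> R\<^sup>*\<^sup>* u v" by blast
  define C where "C = {x \<in> V. R\<^sup>*\<^sup>* u x}"
  have cut: "\<not> R x y" if "x \<in> C" "y \<in> V - C" for x y
    using that rtranclp.rtrancl_into_rtrancl[of R u x y] by (auto simp: C_def)
  have C: "C \<subseteq> V" "u \<in> C" "v \<in> V - C" using uv by (auto simp: C_def)
  show ?thesis
  proof (cases "2 * card C \<le> card V")
    case True
    then show ?thesis using C cut by (intro exI[of _ C]) auto
  next
    case False
    have "card (V - C) = card V - card C"
      using C assms(1) by (intro card_Diff_subset) (auto intro: finite_subset)
    then have "2 * card (V - C) \<le> card V" using False by linarith
    then show ?thesis using C cut sym by (intro exI[of _ "V - C"]) blast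
  qed
qed

section \<open>The size of a shadow\<close>

lemma shadow_eq: "shadow G = (\<lambda>(e, y). e - {y}) ` (SIGMA e:G. e)"
proof (intro equalityI subsetI)
    fix S assume "S \<in> shadow G"
    then obtain y where "y \<notin> S" "insert y S \<in> G" by (auto simp: shadow_def)
    then show "S \<in> (\<lambda>(e, y). e - {y}) ` (SIGMA e:G. e)" 
      by (intro image_eqI[of _ _ "(insert y S, y)"]) auto
  next
    fix S assume "S \<in> (\<lambda>(e, y). e - {y}) ` (SIGMA e:G. e)"
    then obtain e y where "e \<in> G" "y \<in> e" "S = e - {y}" by auto
    then show "S \<in> shadow G" unfolding shadow_def by (auto intro!: exI[of _ y] simp: insert_absorb)
  qed

lemma card_shadow_le:
  assumes "finite G" "\<And>e. e \<in> G \<Longrightarrow> finite e \<and> card e = k"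
  shows "finite (shadow G)" "card (shadow G) \<le> k * card G"
proof -
  have fin: "finite (SIGMA e:G. e)" using assms by auto
  then show "finite (shadow G)" unfolding shadow_eq by simp
  have "card (SIGMA e:G. e) = k * card G"
    using assms by (simp add: card_SigmaI)
  with card_image_le[OF fin] show "card (shadow G) \<le> k * card G" unfolding shadow_eq by metis
qed

text \<open>There are \<open>k * card G\<close> incidences \<open>(e, y)\<close>. In each fibre of
  the map to \<open>e - {y}\<close> one incidence, given by \<open>r\<close>, pays for its set in
  the shadow; every other one yields the pair of edges \<open>(S, r S, y)\<close> in
  \<open>C\<close>, and these triples are distinct.\<close>

lemma card_cherries_le:
  assumes "finite G" "\<And>e. e \<in> G \<Longrightarrow> finite e \<and> card e = k"
    and "finite C" "{(S, x, y). x \<noteq> y \<and> x \<notin> S \<and> y \<notin> S \<and> insert x S \<in> G \<and> insert y S \<in> G} \<subseteq> C"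
  shows "k * card G \<le> card (shadow G) + card C"
proof -
  define J where "J = (SIGMA e:G. e)"
  have finJ: "finite J" using assms unfolding J_def by auto
  have cardJ: "card J = k * card G"
    unfolding J_def using assms by (simp add: card_SigmaI)
  have sh: "shadow G = (\<lambda>(e, y). e - {y}) ` J" unfolding J_def by (rule shadow_eq)
  have fin: "finite (shadow G)" using assms(1,2) by (intro card_shadow_le) auto
  have "\<forall>S\<in>shadow G. \<exists>y. y \<notin> S \<and> insert y S \<in> G" by (auto simp: shadow_def)
  then obtain r where r: "\<And>S. S \<in> shadow G \<Longrightarrow> r S \<notin> S \<and> insert (r S) S \<in> G" by metis
  define f where "f = (\<lambda>(e, y). (e - {y}, r (e - {y}), y))"
  have mem: "e - {y} \<in> shadow G" if "(e, y) \<in> J" for e y using that sh by force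
  have inj: "inj_on f J"
    by (auto simp: inj_on_def f_def J_def; metis insert_Diff)
  have "f ` J \<subseteq> (\<lambda>S. (S, r S, r S)) ` shadow G \<union> C"
  proof
    fix z assume "z \<in> f ` J"
    then obtain e y where ey: "(e, y) \<in> J" "z = (e - {y}, r (e - {y}), y)" by (auto simp: f_def)
    have e: "insert y (e - {y}) \<in> G" using ey by (auto simp: J_def insert_absorb)
    show "z \<in> (\<lambda>S. (S, r S, r S)) ` shadow G \<union> C"
    proof (cases "r (e - {y}) = y")
      case True
      then show ?thesis using ey mem[OF ey(1)] by (intro UnI1 image_eqI[of _ _ "e - {y}"]) simp_all
    next
      case False
      then have "z \<in> {(S, x, y). x \<noteq> y \<and> x \<notin> S \<and> y \<notin> S \<and> insert x S \<in> G \<and> insert y S \<in> G}"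
        using r[OF mem[OF ey(1)]] e ey(2) by auto
      then show ?thesis using assms(4) by blast
    qed
  qed
  then have "card (f ` J) \<le> card ((\<lambda>S. (S, r S, r S)) ` shadow G \<union> C)"
    using fin assms(3) by (intro card_mono) auto
  also have "\<dots> \<le> card ((\<lambda>S. (S, r S, r S)) ` shadow G) + card C" by (rule card_Un_le)
  also have "\<dots> \<le> card (shadow G) + card C" using fin by (intro add_mono card_image_le) auto
  finally show "k * card G \<le> card (shadow G) + card C"
    using inj cardJ by (simp add: card_image)
qed

section \<open>Counting vertex sets, and a Chernoff bound\<close>

lemma finite_possible_edges [simp]: "finite (possible_edges k n)"
  unfolding possible_edges_def by (rule finite_subset[of _ "Pow {1..n}"]) auto

lemma card_possible_edges: "card (possible_edges k n) = n choose k"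
  unfolding possible_edges_def using n_subsets[of "{1..n}" k] by simp

lemma possible_edgesD:
  "e \<in> possible_edges k n \<Longrightarrow> e \<subseteq> {1..n} \<and> finite e \<and> card e = k"
  by (auto simp: possible_edges_def intro: finite_subset)

lemma card_subsets_le_power: "card {S. S \<subseteq> {1..n::nat} \<and> card S = j} \<le> n ^ j"
proof (cases "j \<le> n")
  case True
  then show ?thesis using n_subsets[of "{1..n}" j] binomial_le_pow[of j n] by simp
next
  case False
  then have "n choose j = 0" by (simp add: binomial_eq_0)
  then have "card {S. S \<subseteq> {1..n} \<and> card S = j} = 0"
    using n_subsets[of "{1..n}" j] by (simp only: card_atLeastAtMost finite_atLeastAtMost diff_Suc_1)
  then show ?thesis by linarith
qed

text \<open>With \<open>t\<close> inside the event, positive \<open>t\<close> gives the upper tail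
  and negative \<open>t\<close> the lower tail. Both are used.\<close>

lemma rprob_chernoff:
  assumes "finite D" "0 \<le> p" "p \<le> 1"
  shows "rprob D p (\<lambda>H. t * real (card H) \<ge> y) \<le> exp (real (card D) * p * (exp t - 1) - y)"
proof -
  let ?E = "measure_pmf.expectation (random_subset D p)"
  have "rprob D p (\<lambda>H. t * real (card H) \<ge> y) = rprob D p (\<lambda>H. exp (t * real (card H)) \<ge> exp y)"
    by simp
  also have "\<dots> \<le> ?E (\<lambda>H. exp (t * real (card H))) / exp y"
    using integral_Markov_inequality_measure[of "random_subset D p" "\<lambda>H. exp (t * real (card H))" "{}" "exp y"]
      assms by simp
  also have "?E (\<lambda>H. exp (t * real (card H))) = (1 + p * (exp t - 1)) ^ card D"
    using assms by (subst expectation_exp_card) (simp_all add: algebra_simps)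
  also have "\<dots> \<le> exp (p * (exp t - 1)) ^ card D"
  proof (intro power_mono exp_ge_add_one_self)
    have "0 \<le> p * exp t" using assms by simp
    moreover have "1 + p * (exp t - 1) = (1 - p) + p * exp t" by (simp add: algebra_simps)
    ultimately show "0 \<le> 1 + p * (exp t - 1)" using assms by linarith
  qed
  also have "\<dots> = exp (real (card D) * p * (exp t - 1))"
    by (simp add: exp_of_nat_mult[symmetric])
  finally show ?thesis by (simp add: exp_diff divide_right_mono)
qed

section \<open>Below the threshold: an isolated vertex\<close>

lemma card_pairs_meeting_le:
  assumes "U \<subseteq> {1..n::nat}" "k \<ge> 2"
  shows "finite {(S, y). S \<subseteq> {1..n} \<and> card S = k - 1 \<and> y \<in> {1..n} \<and> insert y S \<inter> U \<noteq> {}}"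
    and "card {(S, y). S \<subseteq> {1..n} \<and> card S = k - 1 \<and> y \<in> {1..n} \<and> insert y S \<inter> U \<noteq> {}}
           \<le> 2 * card U * n ^ (k - 1)"
proof -
  let ?C = "{(S, y). S \<subseteq> {1..n} \<and> card S = k - 1 \<and> y \<in> {1..n} \<and> insert y S \<inter> U \<noteq> {}}"
  let ?P = "\<lambda>j. {S. S \<subseteq> {1..n} \<and> card S = j}"
  have finP: "finite (?P j)" for j by (rule finite_subset[of _ "Pow {1..n}"]) auto
  have finU: "finite U" using assms finite_subset by auto
  \<comment> \<open>Either \<open>y\<close> or some \<open>z \<in> S\<close> lies in
    \<open>U\<close>. Choosing that vertex from \<open>U\<close> replaces a factor \<open>n\<close>
    by \<open>card U\<close>, and the two cases account for the factor 2.\<close>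
  have sub: "?C \<subseteq> ?P (k - 1) \<times> U \<union> (\<lambda>(z, S, y). (insert z S, y)) ` (U \<times> ?P (k - 2) \<times> {1..n})"
  proof
    fix c assume "c \<in> ?C"
    then obtain S y where c: "c = (S, y)" "S \<subseteq> {1..n}" "card S = k - 1" "y \<in> {1..n}"
      "insert y S \<inter> U \<noteq> {}" by auto
    show "c \<in> ?P (k - 1) \<times> U \<union> (\<lambda>(z, S, y). (insert z S, y)) ` (U \<times> ?P (k - 2) \<times> {1..n})"
    proof (cases "y \<in> U")
      case True
      then show ?thesis using c by auto
    next
      case False
      then obtain z where z: "z \<in> S" "z \<in> U" using c by auto
      have "finite S" using c finite_subset by auto
      then have "card (S - {z}) = k - 2" using z c by simp
      then have "(z, S - {z}, y) \<in> U \<times> ?P (k - 2) \<times> {1..n}" using z c by auto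
      moreover have "c = (\<lambda>(z, S, y). (insert z S, y)) (z, S - {z}, y)"
        using z c by (auto simp: insert_absorb)
      ultimately show ?thesis by blast
    qed
  qed
  show "finite ?C" using finP finU by (intro finite_subset[OF sub]) auto
  have "card ?C \<le> card (?P (k - 1) \<times> U \<union> (\<lambda>(z, S, y). (insert z S, y)) ` (U \<times> ?P (k - 2) \<times> {1..n}))"
    using finP finU by (intro card_mono[OF _ sub]) auto
  also have "\<dots> \<le> card (?P (k - 1) \<times> U) + card (U \<times> ?P (k - 2) \<times> {1..n})"
    using finP finU by (intro order.trans[OF card_Un_le] add_mono card_image_le) auto
  also have "\<dots> = card (?P (k - 1)) * card U + card U * (card (?P (k - 2)) * n)"
    by (simp add: card_cartesian_product)
  also have "\<dots> \<le> n ^ (k - 1) * card U + card U * (n ^ (k - 2) * n)"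
    by (intro add_mono mult_mono card_subsets_le_power) auto
  also have "n ^ (k - 2) * n = n ^ (k - 1)"
    using assms(2) by (subst power_Suc2[symmetric]) (simp add: Suc_diff_Suc numeral_2_eq_2)
  finally show "card ?C \<le> 2 * card U * n ^ (k - 1)" by (simp add: algebra_simps)
qed

text \<open>\<open>T\<close> stands for the shadow of the edges outside \<open>U\<close>, already
  exposed, and \<open>B\<close> for the unexposed edges. A vertex escapes isolation through a set of
  \<open>T\<close>, where independence applies, or through two edges of \<open>B\<close>, both
  meeting \<open>U\<close>, where a union bound suffices.\<close>

lemma rprob_no_isolated_cond_le:
  fixes n k :: nat and U U' :: "nat set"
  defines "D \<equiv> possible_edges k n"
  defines "B \<equiv> {e \<in> D. \<not> e \<subseteq> {1..n} - U}"
  assumes "k \<ge> 2" "0 \<le> p" "p \<le> 1" "U \<subseteq> {1..n}" "U' \<subseteq> U"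
    and T: "\<And>S. S \<in> T \<Longrightarrow> S \<subseteq> {1..n} - U \<and> card S = k - 1"
  shows "rprob B p (\<lambda>Y. \<forall>u\<in>U'. (\<exists>S\<in>T. insert u S \<in> Y) \<or> (\<exists>y. adj Y u y))
     \<le> (1 - (1 - p) ^ card T) ^ card U' +
        real (card U') * (2 * real (card U) * real n ^ (k - 1) * ((1 - p) ^ card T * p\<^sup>2))"
proof -
  have finB: "finite B" unfolding B_def D_def by auto
  have finU: "finite U" "finite U'" using assms finite_subset[of U "{1..n}"] finite_subset[of U' U] by auto
  have finT: "finite T" using T by (intro finite_subset[of T "Pow {1..n}"]) auto
  define X where "X = (\<lambda>u. (\<lambda>S. insert u S) ` T)"
  have finS: "finite S" if "S \<in> T" for S using T[OF that] finite_subset[of S "{1..n}"] by auto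
  have XB: "X u \<subseteq> B" if "u \<in> U" for u
  proof
    fix e assume "e \<in> X u"
    then obtain S where S: "S \<in> T" "e = insert u S" by (auto simp: X_def)
    then have "u \<notin> S" using T[OF S(1)] that by auto
    then have "card e = k" using S T[OF S(1)] finS assms by simp
    moreover have "u \<in> {1..n}" "S \<subseteq> {1..n}" using T[OF S(1)] that assms(6) by auto
    ultimately show "e \<in> B" using S(2) that by (auto simp: B_def D_def possible_edges_def)
  qed
  have cardX: "card (X u) = card T" if "u \<in> U" for u
  proof -
    have "u \<notin> S" if "S \<in> T" for S using T[OF that] \<open>u \<in> U\<close> by auto
    then show ?thesis unfolding X_def by (intro card_image inj_onI) (metis insert_ident)
  qed
  \<comment> \<open>Sets of \<open>T\<close> avoid \<open>U\<close>, so an edge of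
    \<open>X u\<close> meets \<open>U\<close> in \<open>u\<close> alone.\<close>
  have disj: "disjoint_family_on X U'"
    unfolding disjoint_family_on_def X_def using T \<open>U' \<subseteq> U\<close> by (fastforce simp: set_eq_iff)
  \<comment> \<open>The second alternative keeps the condition that \<open>Y\<close> misses
    \<open>X u\<close>. Its factor \<open>(1 - p) ^ card T\<close> later compensates the size of
    \<open>U'\<close>, which may be a power of \<open>n\<close>.\<close>
  have "rprob B p (\<lambda>Y. \<forall>u\<in>U'. (\<exists>S\<in>T. insert u S \<in> Y) \<or> (\<exists>y. adj Y u y)) \<le>
     rprob B p (\<lambda>Y. (\<forall>u\<in>U'. Y \<inter> X u \<noteq> {}) \<or> (\<exists>u\<in>U'. Y \<inter> X u = {} \<and> (\<exists>y. adj Y u y)))"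
  proof (intro rprob_mono)
    fix Y assume Y: "\<forall>u\<in>U'. (\<exists>S\<in>T. insert u S \<in> Y) \<or> (\<exists>y. adj Y u y)"
    have "Y \<inter> X u \<noteq> {}" if "\<exists>S\<in>T. insert u S \<in> Y" for u using that by (auto simp: X_def)
    with Y show "(\<forall>u\<in>U'. Y \<inter> X u \<noteq> {}) \<or> (\<exists>u\<in>U'. Y \<inter> X u = {} \<and> (\<exists>y. adj Y u y))"
      by metis
  qed
  also have "\<dots> \<le> rprob B p (\<lambda>Y. \<forall>u\<in>U'. Y \<inter> X u \<noteq> {}) +
      rprob B p (\<lambda>Y. \<exists>u\<in>U'. Y \<inter> X u = {} \<and> (\<exists>y. adj Y u y))"
    by (rule rprob_Un_le)
  finally have le: "rprob B p (\<lambda>Y. \<forall>u\<in>U'. (\<exists>S\<in>T. insert u S \<in> Y) \<or> (\<exists>y. adj Y u y)) \<le> \<dots>" .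
  have "rprob B p (\<lambda>Y. \<forall>u\<in>U'. Y \<inter> X u \<noteq> {}) = (\<Prod>u\<in>U'. rprob B p (\<lambda>Y. Y \<inter> X u \<noteq> {}))"
    using XB finB finU disj \<open>U' \<subseteq> U\<close> by (intro rprob_indep_family) auto
  also have "\<dots> = (\<Prod>u\<in>U'. 1 - (1 - p) ^ card T)"
    using XB finB cardX assms by (intro prod.cong refl) (auto simp: rprob_not rprob_disjnt)
  also have "\<dots> = (1 - (1 - p) ^ card T) ^ card U'" by simp
  finally have le1: "rprob B p (\<lambda>Y. \<forall>u\<in>U'. Y \<inter> X u \<noteq> {}) = \<dots>" .
  have "rprob B p (\<lambda>Y. \<exists>u\<in>U'. Y \<inter> X u = {} \<and> (\<exists>y. adj Y u y)) \<le>
     (\<Sum>u\<in>U'. rprob B p (\<lambda>Y. Y \<inter> X u = {} \<and> (\<exists>y. adj Y u y)))"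
    using finU by (intro rprob_ex_le)
  also have "\<dots> \<le> (\<Sum>u\<in>U'. 2 * real (card U) * real n ^ (k - 1) * ((1 - p) ^ card T * p\<^sup>2))"
  proof (intro sum_mono)
    fix u assume "u \<in> U'"
    then have u: "u \<in> U" using assms by auto
    let ?C = "{(S, y). S \<subseteq> {1..n} \<and> card S = k - 1 \<and> y \<in> {1..n} \<and> insert y S \<inter> U \<noteq> {}}"
    let ?Q = "\<lambda>S y Y. Y \<inter> X u = {} \<and> y \<noteq> u \<and> u \<notin> S \<and> {insert u S, insert y S} \<subseteq> Y"
    note C = card_pairs_meeting_le[OF \<open>U \<subseteq> {1..n}\<close> \<open>k \<ge> 2\<close>]
    have "rprob B p (\<lambda>Y. Y \<inter> X u = {} \<and> (\<exists>y. adj Y u y)) \<le> rprob B p (\<lambda>Y. \<exists>c\<in>?C. ?Q (fst c) (snd c) Y)"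
    proof (intro rprob_mono)
      fix Y assume Y: "Y \<subseteq> B" "Y \<inter> X u = {} \<and> (\<exists>y. adj Y u y)"
      then obtain y S where S: "u \<noteq> y" "u \<notin> S" "y \<notin> S" "insert u S \<in> Y" "insert y S \<in> Y"
        by (auto simp: adj_def)
      have e: "insert y S \<in> B" using S Y by auto
      have e': "insert y S \<subseteq> {1..n}" "finite (insert y S)" "card (insert y S) = k"
      proof -
        have "insert y S \<in> possible_edges k n" using e by (simp add: B_def D_def)
        then show "insert y S \<subseteq> {1..n}" "finite (insert y S)" "card (insert y S) = k"
          using possible_edgesD by metis+
      qed
      then have "card S = k - 1" using S by simp
      moreover have "insert y S \<inter> U \<noteq> {}" using e e'(1) by (auto simp: B_def)
      ultimately have "(S, y) \<in> ?C" using e' by auto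
      then show "\<exists>c\<in>?C. ?Q (fst c) (snd c) Y" using S Y by (intro bexI[of _ "(S, y)"]) auto
    qed
    also have "\<dots> \<le> (\<Sum>c\<in>?C. rprob B p (?Q (fst c) (snd c)))"
      by (rule rprob_ex_le[OF C(1)])
    also have "\<dots> \<le> (\<Sum>c\<in>?C. (1 - p) ^ card T * p\<^sup>2)"
    proof (intro sum_mono)
      fix c assume "c \<in> ?C"
      obtain S y where c: "c = (S, y)" by (cases c)
      let ?Z = "{insert u S, insert y S}"
      \<comment> \<open>If \<open>?Z\<close> meets \<open>X u\<close>, the event contradicts itself;
        otherwise its two conditions concern disjoint sets of edges.\<close>
      show "rprob B p (?Q (fst c) (snd c)) \<le> (1 - p) ^ card T * p\<^sup>2"
      proof (cases "y \<noteq> u \<and> u \<notin> S \<and> ?Z \<subseteq> B \<and> ?Z \<inter> X u = {}")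
        case True
        have "u \<notin> insert y S" using True by simp
        then have "insert u S \<noteq> insert y S" by (metis insertI1)
        then have 2: "card ?Z = 2" by simp
        have "rprob B p (?Q (fst c) (snd c)) \<le> rprob B p (\<lambda>Y. Y \<inter> X u = {} \<and> ?Z \<subseteq> Y \<inter> ?Z)"
          unfolding c by (intro rprob_mono) auto
        also have "\<dots> = rprob B p (\<lambda>Y. Y \<inter> X u = {}) * rprob B p (\<lambda>Y. ?Z \<subseteq> Y \<inter> ?Z)"
        proof (rule rprob_indep2'[where Q = "\<lambda>Y. Y = {}" and R = "\<lambda>Y. ?Z \<subseteq> Y"])
          show "X u \<inter> ?Z = {}" using True by (subst Int_commute) blast
        qed (use True XB[OF u] finB in blast)+
        also have "rprob B p (\<lambda>Y. ?Z \<subseteq> Y \<inter> ?Z) = rprob B p (\<lambda>Y. ?Z \<subseteq> Y)"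
          by (intro rprob_cong) auto
        also have "\<dots> = p\<^sup>2" using True finB assms 2 by (subst rprob_superset) auto
        also have "rprob B p (\<lambda>Y. Y \<inter> X u = {}) = (1 - p) ^ card T"
          using XB[OF u] cardX[OF u] finB assms by (simp add: rprob_disjnt)
        finally show ?thesis .
      next
        case False
        have "rprob B p (?Q (fst c) (snd c)) \<le> rprob B p (\<lambda>Y. False)"
          unfolding c using False by (intro rprob_mono) auto
        then show ?thesis using assms by (auto intro: order.trans)
      qed
    qed
    also have "\<dots> = real (card ?C) * ((1 - p) ^ card T * p\<^sup>2)" by simp
    also have "\<dots> \<le> (2 * real (card U) * real n ^ (k - 1)) * ((1 - p) ^ card T * p\<^sup>2)"
    proof (intro mult_right_mono)
      show "real (card ?C) \<le> 2 * real (card U) * real n ^ (k - 1)"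
        using of_nat_mono[OF C(2), where 'a = real] by (simp only: of_nat_mult of_nat_power of_nat_numeral)
    qed (use assms in auto)
    finally show "rprob B p (\<lambda>Y. Y \<inter> X u = {} \<and> (\<exists>y. adj Y u y)) \<le>
       2 * real (card U) * real n ^ (k - 1) * ((1 - p) ^ card T * p\<^sup>2)" .
  qed
  also have "\<dots> = real (card U') * (2 * real (card U) * real n ^ (k - 1) * ((1 - p) ^ card T * p\<^sup>2))"
    by simp
  finally show ?thesis by (intro order.trans[OF le] add_mono) (simp_all only: le1 order.refl)
qed

text \<open>The vertices of \<open>U\<close> are tested against the shadow of the hypergraph induced on the complement
  of \<open>U\<close>. The tested set \<open>U'\<close> depends on that hypergraph: it is just large enough for some vertex of it
  to avoid the shadow, and so small that no such vertex has a neighbour through two edges that both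
  meet \<open>U\<close>.\<close>

lemma rprob_no_isolated_le:
  fixes n k :: nat and U :: "nat set"
  defines "D \<equiv> possible_edges k n"
  assumes "k \<ge> 2" "0 \<le> p" "p \<le> 1" "U \<subseteq> {1..n}" "L > 0" "q > 0"
    and q: "\<And>j. real j \<le> K \<Longrightarrow> q \<le> (1 - p) ^ j"
    and U: "L / q \<le> real (card U)"
  shows "rprob D p (\<lambda>H. \<forall>u\<in>{1..n}. \<exists>y. adj H u y) \<le>
     rprob {e \<in> D. e \<subseteq> {1..n} - U} p (\<lambda>G. real (k * card G) > K) +
     (exp (- L) + (L + 1) * (2 * real (card U) * real n ^ (k - 1) * p\<^sup>2))"
proof -
  let ?A = "{e \<in> D. e \<subseteq> {1..n} - U}" and ?B = "{e \<in> D. \<not> e \<subseteq> {1..n} - U}"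
  have fin: "finite D" "finite ?A" "finite ?B" unfolding D_def by auto
  have AB: "?A \<union> ?B = D" "?A \<inter> ?B = {}" by auto
  have sh: "finite (shadow G)" "card (shadow G) \<le> k * card G"
       "\<And>S. S \<in> shadow G \<Longrightarrow> S \<subseteq> {1..n} - U \<and> card S = k - 1"
    if "G \<subseteq> ?A" for G
  proof -
    have G: "finite G" using that fin(2) finite_subset by blast
    have Ge: "e \<subseteq> {1..n} - U \<and> finite e \<and> card e = k" if "e \<in> G" for e
      using that \<open>G \<subseteq> ?A\<close> possible_edgesD[of e k n] unfolding D_def by blast
    show 3: "S \<subseteq> {1..n} - U \<and> card S = k - 1" if "S \<in> shadow G" for S
    proof -
      from that obtain y where "y \<notin> S" "insert y S \<in> G" unfolding shadow_def by blast
      then show ?thesis using Ge[of "insert y S"] by auto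
    qed
    show "finite (shadow G)" "card (shadow G) \<le> k * card G"
      using card_shadow_le[of G k] G Ge by auto
  qed
  \<comment> \<open>The middle quantity is the expected number of vertices of \<open>U'\<close> that
    avoid the shadow. Being at least \<open>L\<close> it makes failure as rare as
    \<open>exp (- L)\<close>; being at most \<open>L + 1\<close> it limits the union bound over
    pairs.\<close>
  let ?P = "\<lambda>G U'. U' \<subseteq> U \<and> L \<le> (1 - p) ^ card (shadow G) * real (card U') \<and>
             (1 - p) ^ card (shadow G) * real (card U') \<le> L + 1"
  have ex: "\<exists>U'. ?P G U'" if "G \<subseteq> ?A" "real (k * card G) \<le> K" for G
  proof -
    let ?q = "(1 - p) ^ card (shadow G)"
    have "real (card (shadow G)) \<le> real (k * card G)" using sh(2)[OF that(1)] by (simp only: of_nat_le_iff)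
    then have qq: "q \<le> ?q" using that by (intro q) auto
    then have pos: "?q > 0" "?q \<le> 1" using assms by (auto intro: power_le_one)
    \<comment> \<open>The least size that reaches \<open>L\<close>. Rounding up adds at most
      \<open>?q \<le> 1\<close> to the expected number.\<close>
    define j where "j = nat \<lceil>L / ?q\<rceil>"
    have j: "L / ?q \<le> real j" "real j \<le> L / ?q + 1" using pos assms by (auto simp: j_def)
    have "L / ?q \<le> L / q" using qq assms by (intro divide_left_mono) auto
    then have "j \<le> card U" using U by (simp add: j_def nat_le_iff ceiling_le_iff)
    then obtain U' where U': "U' \<subseteq> U" "card U' = j" using obtain_subset_with_card_n by metis
    have "?q * real j \<le> ?q * (L / ?q + 1)" using j pos by (intro mult_left_mono) auto
    also have "\<dots> = L + ?q"
      using pos(1) less_imp_neq[OF pos(1)] by (simp only: distrib_left nonzero_mult_div_cancel_left times_divide_eq_right mult_1_right)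
    finally have "?q * real j \<le> L + 1" using pos by linarith
    moreover have "L \<le> ?q * real j" using j(1) pos(1) by (simp only: pos_divide_le_eq mult.commute)
    ultimately show ?thesis using U' by blast
  qed
  define f where "f G = (SOME U'. ?P G U')" for G :: "nat set set"
  have f: "f G \<subseteq> U \<and> L \<le> (1 - p) ^ card (shadow G) * real (card (f G)) \<and>
     (1 - p) ^ card (shadow G) * real (card (f G)) \<le> L + 1"
    if "G \<subseteq> ?A" "real (k * card G) \<le> K" for G
    unfolding f_def using ex[OF that] by (rule someI_ex)
  let ?Q = "\<lambda>G Y. real (k * card G) \<le> K \<and>
      (\<forall>u\<in>f G. (\<exists>S\<in>shadow G. insert u S \<in> Y) \<or> (\<exists>y. adj Y u y))"
  have "rprob D p (\<lambda>H. \<forall>u\<in>{1..n}. \<exists>y. adj H u y) \<le>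
     rprob D p (\<lambda>H. real (k * card (H \<inter> ?A)) > K \<or> ?Q (H \<inter> ?A) (H \<inter> ?B))"
  proof (intro rprob_mono)
    fix H assume H: "H \<subseteq> D" "\<forall>u\<in>{1..n}. \<exists>y. adj H u y"
    show "real (k * card (H \<inter> ?A)) > K \<or> ?Q (H \<inter> ?A) (H \<inter> ?B)"
    proof (cases "real (k * card (H \<inter> ?A)) \<le> K")
      case True
      have "(\<exists>S\<in>shadow (H \<inter> ?A). insert u S \<in> H \<inter> ?B) \<or> (\<exists>y. adj (H \<inter> ?B) u y)" if "u \<in> f (H \<inter> ?A)" for u
      proof -
        have u: "u \<in> U" using f[of "H \<inter> ?A"] True that by blast
        then obtain y S where S: "u \<noteq> y" "u \<notin> S" "y \<notin> S" "insert u S \<in> H" "insert y S \<in> H"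
          using H(2) assms(5) unfolding adj_def by blast
        \<comment> \<open>Every edge through \<open>u \<in> U\<close> is unexposed. Whether its
          partner avoids \<open>U\<close> decides between the shadow and a pair of unexposed
          edges.\<close>
        have 1: "insert u S \<in> H \<inter> ?B" using S u H by auto
        show ?thesis
        proof (cases "insert y S \<in> ?A")
          case True
          then have "S \<in> shadow (H \<inter> ?A)" unfolding shadow_def using S by blast
          then show ?thesis using 1 by blast
        next
          case False
          then have "insert y S \<in> H \<inter> ?B" using S H by blast
          then show ?thesis unfolding adj_def using 1 S by blast
        qed
      qed
      then show ?thesis using True by blast
    qed auto
  qed
  also have "\<dots> \<le> rprob D p (\<lambda>H. real (k * card (H \<inter> ?A)) > K) + rprob D p (\<lambda>H. ?Q (H \<inter> ?A) (H \<inter> ?B))"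
    by (rule rprob_Un_le)
  finally have le: "rprob D p (\<lambda>H. \<forall>u\<in>{1..n}. \<exists>y. adj H u y) \<le> \<dots>" .
  have le1: "rprob D p (\<lambda>H. real (k * card (H \<inter> ?A)) > K) = rprob ?A p (\<lambda>G. real (k * card G) > K)"
    using fin by (intro rprob_restrict) auto
  have "rprob D p (\<lambda>H. ?Q (H \<inter> ?A) (H \<inter> ?B)) \<le>
       exp (- L) + (L + 1) * (2 * real (card U) * real n ^ (k - 1) * p\<^sup>2)"
  proof -
    have "rprob ?B p (?Q G) \<le> exp (- L) + (L + 1) * (2 * real (card U) * real n ^ (k - 1) * p\<^sup>2)"
      if G: "G \<subseteq> ?A" for G
    proof (cases "real (k * card G) \<le> K")
      case True
      let ?q = "(1 - p) ^ card (shadow G)"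
      have q01: "0 \<le> ?q" "?q \<le> 1" using assms by (auto intro: power_le_one)
      note fG = f[OF G True]
      let ?b = "2 * real (card U) * real n ^ (k - 1) * p\<^sup>2"
      have "rprob ?B p (?Q G) \<le>
         rprob ?B p (\<lambda>Y. \<forall>u\<in>f G. (\<exists>S\<in>shadow G. insert u S \<in> Y) \<or> (\<exists>y. adj Y u y))"
        by (intro rprob_mono) auto
      also have "\<dots> \<le> (1 - ?q) ^ card (f G) +
          real (card (f G)) * (2 * real (card U) * real n ^ (k - 1) * (?q * p\<^sup>2))"
        unfolding D_def using fG sh(3)[OF G] assms
        by (intro rprob_no_isolated_cond_le) auto
      finally have le: "rprob ?B p (?Q G) \<le> \<dots>" .
      have "(1 - ?q) ^ card (f G) \<le> exp (- ?q) ^ card (f G)"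
        using q01 exp_ge_add_one_self[of "- ?q"] by (intro power_mono) auto
      also have "\<dots> = exp (- (?q * real (card (f G))))"
        by (simp add: exp_of_nat_mult[symmetric] mult.commute)
      also have "\<dots> \<le> exp (- L)" using fG by simp
      finally have le1: "(1 - ?q) ^ card (f G) \<le> exp (- L)" .
      have "real (card (f G)) * (2 * real (card U) * real n ^ (k - 1) * (?q * p\<^sup>2)) =
          (?q * real (card (f G))) * (2 * real (card U) * real n ^ (k - 1) * p\<^sup>2)" by simp
      also have "\<dots> \<le> (L + 1) * (2 * real (card U) * real n ^ (k - 1) * p\<^sup>2)"
        using fG by (intro mult_right_mono) auto
      finally show ?thesis by (intro order.trans[OF le] add_mono le1)
    next
      case False
      then have "rprob ?B p (?Q G) = 0" by simp
      then show ?thesis using assms by (simp add: add_nonneg_nonneg)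
    qed
    from rprob_cond_le[OF fin(2,3) AB(2), of p ?Q, OF this] show ?thesis unfolding AB(1) by simp
  qed
  then show ?thesis by (intro order.trans[OF le] add_mono) (simp_all only: le1 order.refl)
qed

section \<open>The threshold function and its limit below\<close>

definition trail_threshold :: "nat \<Rightarrow> nat \<Rightarrow> real" where
  "trail_threshold k n = sqrt (fact (k - 1) * ln (real n) / real n ^ k)"

lemma trail_threshold_nonneg [simp]: "trail_threshold k n \<ge> 0"
  unfolding trail_threshold_def by (cases "n = 0") auto

lemma trail_threshold_pos: "n \<ge> 2 \<Longrightarrow> trail_threshold k n > 0"
  unfolding trail_threshold_def by auto

lemma power_times_trail_threshold_sq:
  assumes "n \<ge> 1"
  shows "real n ^ k * (trail_threshold k n)\<^sup>2 = fact (k - 1) * ln (real n)"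
proof -
  have "0 \<le> fact (k - 1) * ln (real n) / real n ^ k" using assms by auto
  then show ?thesis using assms unfolding trail_threshold_def by simp
qed

lemma tendsto_trail_threshold:
  assumes "k \<ge> 1"
  shows "trail_threshold k \<longlonglongrightarrow> 0"
proof (rule tendsto_sandwich[OF _ _ tendsto_const])
  show "(\<lambda>n. sqrt (fact (k - 1) * ln (real n) / real n)) \<longlonglongrightarrow> 0" by real_asymp
  show "\<forall>\<^sub>F n in sequentially. trail_threshold k n \<le> sqrt (fact (k - 1) * ln (real n) / real n)"
    using eventually_ge_at_top[of 1]
  proof eventually_elim
    case (elim n)
    then have "real n ^ 1 \<le> real n ^ k" using assms by (intro power_increasing) auto
    then show ?case unfolding trail_threshold_def using elim
      by (intro real_sqrt_le_mono divide_left_mono) auto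
  qed
qed auto

text \<open>The slack \<open>(1 - \<epsilon>)\<^sup>2\<close> in \<open>n^k * p^2\<close> is spent
  in two places: one factor pays for the deviation of the number of edges from its mean, the other
  survives in the exponent. There it is multiplied by \<open>1 + \<epsilon>\<close>, the loss in
  bounding \<open>- ln (1 - r)\<close> by a multiple of \<open>r\<close>, which gives
  \<open>1 - \<epsilon>\<^sup>2\<close>.\<close>

lemma rprob_no_isolated_tendsto_0:
  fixes p :: "nat \<Rightarrow> real"
  assumes k: "k \<ge> 3" and e: "0 < \<epsilon>" "\<epsilon> \<le> 1 / 2" and p: "\<And>n. 0 \<le> p n \<and> p n \<le> 1"
    and le: "\<forall>\<^sub>F n in sequentially. p n \<le> (1 - \<epsilon>) * trail_threshold k n"
  shows "(\<lambda>n. rprob (possible_edges k n) (p n) (\<lambda>H. \<forall>u\<in>{1..n}. \<exists>y. adj H u y)) \<longlonglongrightarrow> 0"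
proof (rule tendsto_sandwich[OF _ _ tendsto_const])
  define c :: real where "c = fact (k - 1)"
  \<comment> \<open>The terms stand for too many edges outside \<open>U\<close>, for no tested
    vertex avoiding the shadow, and for pairs of edges that both meet \<open>U\<close>.\<close>
  define b where "b n = real n powr (- (\<epsilon> ^ 3 / (2 * k))) + (1 / real n +
     (ln (real n) + 1) * (2 * (ln (real n) * real n powr (1 - \<epsilon>\<^sup>2) + 1) * (c * ln (real n) / real n)))" for n :: nat
  have c: "c > 0" unfolding c_def by simp
  have e2: "\<epsilon>\<^sup>2 < 1" using e by (simp add: power_less_one_iff)
  show "b \<longlonglongrightarrow> 0"
  proof -
    have "\<epsilon> ^ 3 / (2 * real k) > 0" using e k by simp
    moreover have "\<epsilon>\<^sup>2 > 0" using e by simp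
    moreover note e2
    moreover have "(\<lambda>n. real n powr (- a) + (1 / real n +
        (ln (real n) + 1) * (2 * (ln (real n) * real n powr (1 - d) + 1) * (c * ln (real n) / real n)))) \<longlonglongrightarrow> 0"
      if "a > 0" "d > 0" "d < 1" for a d :: real
    proof (intro tendsto_add_zero)
      show "(\<lambda>n. real n powr (- a)) \<longlonglongrightarrow> 0" using that by real_asymp
      show "(\<lambda>n. 1 / real n) \<longlonglongrightarrow> 0" by real_asymp
      show "(\<lambda>n. (ln (real n) + 1) * (2 * (ln (real n) * real n powr (1 - d) + 1) *
          (c * ln (real n) / real n))) \<longlonglongrightarrow> 0" using that by real_asymp
    qed
    ultimately show ?thesis unfolding b_def of_nat_mult of_nat_numeral by blast
  qed
  \<comment> \<open>This bound on \<open>r\<close> is equivalent to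
    \<open>1 / (1 - r) < 1 + \<epsilon>\<close>.\<close>
  have "(\<lambda>n. (1 - \<epsilon>) * trail_threshold k n) \<longlonglongrightarrow> (1 - \<epsilon>) * 0"
    using k by (intro tendsto_intros tendsto_trail_threshold) auto
  then have small: "\<forall>\<^sub>F n in sequentially. (1 - \<epsilon>) * trail_threshold k n < \<epsilon> / (1 + \<epsilon>)"
    using e by (intro order_tendstoD(2)[where y = "(1 - \<epsilon>) * 0"]) auto
  \<comment> \<open>The test set of about \<open>L / q\<close> vertices must fit into
    \<open>{1..n}\<close>.\<close>
  have room: "\<forall>\<^sub>F n :: nat in sequentially. ln (real n) * real n powr (1 - \<epsilon>\<^sup>2) + 1 \<le> real n"
  proof -
    have "\<forall>\<^sub>F n :: nat in sequentially. ln (real n) * real n powr (1 - d) + 1 \<le> real n"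
      if "d > 0" "d < 1" for d :: real
      using that by real_asymp
    then show ?thesis using e e2 by simp
  qed
  show "\<forall>\<^sub>F n in sequentially.
      rprob (possible_edges k n) (p n) (\<lambda>H. \<forall>u\<in>{1..n}. \<exists>y. adj H u y) \<le> b n"
    using le small room eventually_ge_at_top[of 3]
  proof eventually_elim
    case (elim n)
    define L where "L = ln (real n)"
    define r where "r = (1 - \<epsilon>) * trail_threshold k n"
    \<comment> \<open>The expected number of edges outside \<open>U\<close>, times \<open>k\<close>,
      is at most \<open>(1 - \<epsilon>) * K\<close>, so \<open>K\<close> leaves room for a Chernoff
      bound, while \<open>K * r = (1 - \<epsilon>) * L\<close> still keeps
      \<open>(1 - r) powr K\<close> well above \<open>1 / n\<close>.\<close>
    define K where "K = (1 - \<epsilon>) * L / r"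
    define q where "q = (1 - r) powr K"
    define m where "m = nat \<lceil>L / q\<rceil>"
    have L: "L > 0" using elim by (simp add: L_def)
    have nk: "real n ^ k * r\<^sup>2 = (1 - \<epsilon>)\<^sup>2 * c * L"
    proof -
      have "real n ^ k * r\<^sup>2 = (1 - \<epsilon>)\<^sup>2 * (real n ^ k * (trail_threshold k n)\<^sup>2)"
        unfolding r_def power_mult_distrib by (rule mult.left_commute)
      also have "real n ^ k * (trail_threshold k n)\<^sup>2 = c * L"
        using power_times_trail_threshold_sq[of n k] elim by (simp add: c_def L_def)
      finally show ?thesis by simp
    qed
    have r: "0 < r" "r < \<epsilon> / (1 + \<epsilon>)" "p n \<le> r"
      using elim e trail_threshold_pos[of n k] by (auto simp: r_def)
    have "\<epsilon> / (1 + \<epsilon>) \<le> \<epsilon>" using e by (simp add: field_simps)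
    then have r1: "r < 1 / 2" using r e by linarith
    have K: "K > 0" using L r e by (simp add: K_def)
    have Kr: "K * r = (1 - \<epsilon>) * L" using r by (simp add: K_def)
    have q: "q > 0" using r1 by (simp add: q_def)
    have "q \<le> (1 - p n) ^ j" if "real j \<le> K" for j
    proof -
      have "q \<le> (1 - r) powr real j"
        unfolding q_def using that r r1 by (intro powr_mono') auto
      also have "\<dots> = (1 - r) ^ j" using r1 by (simp add: powr_realpow)
      also have "\<dots> \<le> (1 - p n) ^ j" using r r1 by (intro power_mono) auto
      finally show ?thesis .
    qed
    note qj = this
    have "1 / q \<le> real n powr (1 - \<epsilon>\<^sup>2)"
    proof -
      have "ln (1 / (1 - r)) \<le> 1 / (1 - r) - 1" using r1 by (intro ln_le_minus_one) auto
      then have "- ln (1 - r) \<le> r / (1 - r)" using r1 by (simp add: ln_div field_simps)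
      moreover have "1 / (1 - r) \<le> 1 + \<epsilon>" using r r1 e by (simp add: field_simps)
      ultimately have "- ln (1 - r) \<le> r * (1 + \<epsilon>)"
        using mult_left_mono[of "1 / (1 - r)" "1 + \<epsilon>" r] r by simp
      then have "K * (- ln (1 - r)) \<le> K * (r * (1 + \<epsilon>))" using K by (intro mult_left_mono) auto
      also have "\<dots> = (1 - \<epsilon>\<^sup>2) * L"
        unfolding mult.assoc[symmetric] Kr by (simp add: power2_eq_square algebra_simps)
      finally have "- (K * ln (1 - r)) \<le> (1 - \<epsilon>\<^sup>2) * L" by simp
      then have "exp (- (K * ln (1 - r))) \<le> exp ((1 - \<epsilon>\<^sup>2) * L)" by simp
      moreover have "1 / q = exp (- (K * ln (1 - r)))"
        using r1 by (simp add: q_def powr_def exp_minus field_simps)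
      moreover have "exp ((1 - \<epsilon>\<^sup>2) * L) = real n powr (1 - \<epsilon>\<^sup>2)"
        using elim by (simp add: powr_def L_def)
      ultimately show ?thesis by simp
    qed
    then have "L / q \<le> L * real n powr (1 - \<epsilon>\<^sup>2)" using mult_left_mono[of "1 / q" _ L] L by simp
    moreover have "L / q \<ge> 0" using L q by simp
    ultimately have m: "L / q \<le> real m" "real m \<le> L * real n powr (1 - \<epsilon>\<^sup>2) + 1"
      unfolding m_def by linarith+
    then have "m \<le> n" using elim by (simp add: L_def)
    then obtain U where U: "U \<subseteq> {1..n}" "card U = m"
      using obtain_subset_with_card_n[of m "{1..n}"] by auto
    let ?A = "{e \<in> possible_edges k n. e \<subseteq> {1..n} - U}"
    have main: "rprob (possible_edges k n) (p n) (\<lambda>H. \<forall>u\<in>{1..n}. \<exists>y. adj H u y) \<le>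
        rprob ?A (p n) (\<lambda>G. real (k * card G) > K) +
        (exp (- L) + (L + 1) * (2 * real (card U) * real n ^ (k - 1) * (p n)\<^sup>2))"
      using k p U m L q qj by (intro rprob_no_isolated_le[where q = q]) auto
    have 1: "rprob ?A (p n) (\<lambda>G. real (k * card G) > K) \<le> real n powr (- (\<epsilon> ^ 3 / (2 * k)))"
    proof -
      have "rprob ?A (p n) (\<lambda>G. real (k * card G) > K) \<le>
          rprob ?A (p n) (\<lambda>G. \<epsilon> * real (card G) \<ge> \<epsilon> * (K / k))"
        using e k by (intro rprob_mono) (auto simp: field_simps)
      also have "\<dots> \<le> exp (real (card ?A) * p n * (exp \<epsilon> - 1) - \<epsilon> * (K / k))"
        using p by (intro rprob_chernoff) auto
      also have "\<dots> \<le> exp (- (\<epsilon> ^ 3 / (2 * k)) * L)"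
      proof (subst exp_le_cancel_iff)
        have kf: "fact k = real k * c" using k by (simp add: c_def fact_reduce)
        have "card ?A \<le> n choose k"
          unfolding card_possible_edges[symmetric] by (intro card_mono) auto
        then have "real (card ?A) * fact k \<le> real (n choose k) * fact k"
          by (intro mult_right_mono) auto
        also have "\<dots> = real ((n choose k) * fact k)" by simp
        also have "\<dots> \<le> real n ^ k"
          using binomial_fact_pow[of n k] by (metis of_nat_le_iff of_nat_power)
        finally have cA: "real (card ?A) * (real k * c) \<le> real n ^ k" unfolding kf .
        have "real n ^ k * r = (1 - \<epsilon>) * c * K"
          using nk Kr r by (simp add: K_def power2_eq_square field_simps)
        then have "real (card ?A) * (real k * c) * r \<le> (1 - \<epsilon>) * c * K"
          using mult_right_mono[OF cA, of r] r by simp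
        then have "c * (real k * (real (card ?A) * r)) \<le> c * ((1 - \<epsilon>) * K)"
          by (simp only: mult_ac)
        then have "real k * (real (card ?A) * r) \<le> (1 - \<epsilon>) * K" using c by simp
        then have "real (card ?A) * r \<le> (1 - \<epsilon>) * (K / k)"
          using k by (simp add: field_simps)
        moreover have "real (card ?A) * p n \<le> real (card ?A) * r"
          using r by (intro mult_left_mono) auto
        ultimately have Ap: "real (card ?A) * p n \<le> (1 - \<epsilon>) * (K / k)" by linarith
        \<comment> \<open>The Chernoff parameter is \<open>\<epsilon>\<close> itself:
          \<open>(1 - \<epsilon>) * (\<epsilon> + \<epsilon>\<^sup>2)\<close> falls short of
          \<open>\<epsilon>\<close> by exactly \<open>\<epsilon> ^ 3\<close>.\<close>
        have ee: "exp \<epsilon> - 1 \<le> \<epsilon> + \<epsilon>\<^sup>2" using exp_bound[of \<epsilon>] e by simp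
        have "real (card ?A) * p n * (exp \<epsilon> - 1) \<le> ((1 - \<epsilon>) * (K / k)) * (\<epsilon> + \<epsilon>\<^sup>2)"
          using e p K by (intro mult_mono[OF Ap ee]) auto
        also have "\<dots> = \<epsilon> * (K / k) - \<epsilon> ^ 3 * (K / k)"
        proof -
          have "((1 - \<epsilon>) * x) * (\<epsilon> + \<epsilon>\<^sup>2) = \<epsilon> * x - \<epsilon> ^ 3 * x" for x :: real
            by (simp add: power2_eq_square power3_eq_cube algebra_simps)
          then show ?thesis .
        qed
        finally have "real (card ?A) * p n * (exp \<epsilon> - 1) - \<epsilon> * (K / k) \<le> - (\<epsilon> ^ 3 * (K / k))" by simp
        also have "\<dots> \<le> - (\<epsilon> ^ 3 / (2 * k)) * L"
        proof -
          \<comment> \<open>A crude bound: \<open>K\<close> exceeds \<open>L\<close> by a factor of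
            order \<open>1 / r\<close>, but a negative power of \<open>n\<close> is all that is
            needed.\<close>
          have "L / 2 \<le> (1 - \<epsilon>) * L" using e L by simp
          also have "\<dots> \<le> K" unfolding Kr[symmetric] using K r1 r by (simp add: mult_le_cancel_left1)
          finally have "\<epsilon> ^ 3 / k * (L / 2) \<le> \<epsilon> ^ 3 / k * K" using e by (intro mult_left_mono) auto
          then show ?thesis by (simp add: field_simps)
        qed
        finally show "real (card ?A) * p n * (exp \<epsilon> - 1) - \<epsilon> * (K / k) \<le> - (\<epsilon> ^ 3 / (2 * k)) * L" .
      qed
      also have "\<dots> = real n powr (- (\<epsilon> ^ 3 / (2 * k)))" using elim by (simp add: powr_def L_def)
      finally show ?thesis .
    qed
    have 2: "exp (- L) = 1 / real n" using elim by (simp add: L_def exp_minus field_simps)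
    have "real n ^ (k - 1) * (p n)\<^sup>2 \<le> c * L / real n"
    proof -
      have "(p n)\<^sup>2 \<le> r\<^sup>2" using p r by (intro power_mono) auto
      then have "real n ^ k * (p n)\<^sup>2 \<le> (1 - \<epsilon>)\<^sup>2 * c * L"
        unfolding nk[symmetric] by (intro mult_left_mono) auto
      also have "\<dots> \<le> 1 * c * L" using c L e by (intro mult_right_mono power_le_one) auto
      finally have "real n ^ k * (p n)\<^sup>2 \<le> c * L" by simp
      moreover have "real n ^ k = real n ^ (k - 1) * real n"
        using k by (subst power_Suc2[symmetric]) simp
      ultimately show ?thesis using elim by (simp add: field_simps)
    qed
    then have "2 * real m * (real n ^ (k - 1) * (p n)\<^sup>2) \<le>
        2 * (L * real n powr (1 - \<epsilon>\<^sup>2) + 1) * (c * L / real n)"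
      using m L by (intro mult_mono) auto
    then have "(L + 1) * (2 * real m * (real n ^ (k - 1) * (p n)\<^sup>2)) \<le>
        (L + 1) * (2 * (L * real n powr (1 - \<epsilon>\<^sup>2) + 1) * (c * L / real n))"
      using L by (intro mult_left_mono) auto
    then have 3: "(L + 1) * (2 * real (card U) * real n ^ (k - 1) * (p n)\<^sup>2) \<le>
        (L + 1) * (2 * (L * real n powr (1 - \<epsilon>\<^sup>2) + 1) * (c * L / real n))"
      using U by (simp add: mult.assoc)
    show ?case
      unfolding b_def L_def[symmetric]
      by (rule order.trans[OF main], intro add_mono 1 3) (simp add: 2)
  qed
qed auto

section \<open>Detours at vertices where consecutive steps overlap\<close>

definition detour :: "'a set set \<Rightarrow> 'a \<Rightarrow> 'a set \<Rightarrow> bool" where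
  "detour H x Y \<longleftrightarrow> (\<exists>T a b. a \<noteq> b \<and> a \<notin> T \<and> b \<notin> T \<and> insert a T \<in> H \<and> insert b T \<in> H \<and>
     insert a T \<inter> Y = {x} \<and> insert b T \<inter> Y = {x})"

text \<open>Three blocks of \<open>h\<close> vertices are taken outside \<open>Y\<close>. Each set
  of \<open>k - 2\<close> vertices of the first block, completed by \<open>x\<close>, is one
  attempt; it succeeds if it extends to an edge by a vertex of the second block and also by a vertex
  of the third. Separate blocks make the two extensions distinct and independent.\<close>

lemma rprob_no_detour_le:
  fixes n k h :: nat and Y :: "nat set"
  defines "D \<equiv> possible_edges k n"
  assumes k: "k \<ge> 2" and p: "0 \<le> p" "p \<le> 1" and Y: "Y \<subseteq> {1..n}" "x \<in> Y" and h: "3 * h + card Y \<le> n"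
  shows "rprob D p (\<lambda>H. \<not> detour H x Y) \<le> (1 - (1 - (1 - p) ^ h)\<^sup>2) ^ (h choose (k - 2))"
proof -
  have finD: "finite D" unfolding D_def by simp
  have finY: "finite Y" using Y finite_subset by auto
  have "card ({1..n} - Y) = n - card Y" using Y finY by (simp add: card_Diff_subset)
  then obtain P where P: "P \<subseteq> {1..n} - Y" "card P = 3 * h"
    using obtain_subset_with_card_n[of "3 * h" "{1..n} - Y"] h by (metis le_diff_conv2 le_add2 order.trans)
  have finP: "finite P" using P finite_subset[of P "{1..n}"] by auto
  obtain P1 where P1: "P1 \<subseteq> P" "card P1 = h"
    using obtain_subset_with_card_n[of h P] P by auto
  have "card (P - P1) = 2 * h" using P P1 finP by (subst card_Diff_subset) (auto intro: finite_subset)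
  then obtain P2 where P2: "P2 \<subseteq> P - P1" "card P2 = h"
    using obtain_subset_with_card_n[of h "P - P1"] by auto
  have "card (P - P1 - P2) = h" using P P1 P2 finP \<open>card (P - P1) = 2 * h\<close>
    by (subst card_Diff_subset) (auto intro: finite_subset)
  then obtain P3 where P3: "P3 \<subseteq> P - P1 - P2" "card P3 = h" by blast
  have fin: "finite P1" "finite P2" "finite P3" using P1 P2 P3 finP by (auto intro: finite_subset)
  have V: "P1 \<subseteq> {1..n}" "P2 \<subseteq> {1..n}" "P3 \<subseteq> {1..n}" "x \<in> {1..n}" using P P1 P2 P3 Y by auto
  have nY: "P1 \<inter> Y = {}" "P2 \<inter> Y = {}" "P3 \<inter> Y = {}" using P P1 P2 P3 by auto
  have d: "P1 \<inter> P2 = {}" "P1 \<inter> P3 = {}" "P2 \<inter> P3 = {}" using P1 P2 P3 by auto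
  define I where "I = {T. T \<subseteq> P1 \<and> card T = k - 2}"
  have finI: "finite I" unfolding I_def using fin by auto
  have cardI: "card I = h choose (k - 2)" unfolding I_def using n_subsets[OF fin(1)] P1 by simp
  define E where "E = (\<lambda>T a. insert a (insert x T))"
  define A where "A = (\<lambda>T. E T ` (P2 \<union> P3))"
  have I: "T \<subseteq> P1" "card T = k - 2" "finite T" "x \<notin> T" "T \<inter> (P2 \<union> P3) = {}" if "T \<in> I" for T
    using that fin nY Y d finite_subset[of T P1] unfolding I_def by auto
  have xP: "x \<notin> P1 \<union> P2 \<union> P3" using nY Y by auto
  have ED: "E T a \<in> D" if "T \<in> I" "a \<in> P2 \<union> P3" for T a
  proof -
    have "a \<notin> insert x T" using I[OF that(1)] that(2) xP by auto
    then have "card (E T a) = k" using I[OF that(1)] k by (simp add: E_def)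
    moreover have "E T a \<subseteq> {1..n}" using I(1)[OF that(1)] that(2) V unfolding E_def by blast
    ultimately show ?thesis by (simp add: D_def possible_edges_def)
  qed
  have inj: "inj_on (E T) (P2 \<union> P3)" if "T \<in> I" for T
  proof (rule inj_onI)
    fix a b assume ab: "a \<in> P2 \<union> P3" "b \<in> P2 \<union> P3" "E T a = E T b"
    have "a \<notin> insert x T" using I[OF that] ab xP by auto
    moreover have "a \<in> insert b (insert x T)" using ab(3) unfolding E_def by (metis insertI1)
    ultimately show "a = b" by simp
  qed
  have disj: "disjoint_family_on A I"
  proof (unfold disjoint_family_on_def, intro ballI impI)
    fix T T' assume T: "T \<in> I" "T' \<in> I" "T \<noteq> T'"
    \<comment> \<open>The trace on the first block recovers \<open>T\<close>, so different attempts
      use disjoint sets of edges and are independent.\<close>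
    have "E T a \<inter> P1 = T" if "T \<in> I" "a \<in> P2 \<union> P3" for T a
      using I[OF that(1)] that(2) d xP unfolding E_def by blast
    then have "E T a \<noteq> E T' b" if "a \<in> P2 \<union> P3" "b \<in> P2 \<union> P3" for a b
      using that T by metis
    then show "A T \<inter> A T' = {}" unfolding A_def by blast
  qed
  let ?Q = "\<lambda>T X. \<not> (X \<inter> E T ` P2 \<noteq> {} \<and> X \<inter> E T ` P3 \<noteq> {})"
  have "rprob D p (\<lambda>H. \<not> detour H x Y) \<le> rprob D p (\<lambda>H. \<forall>T\<in>I. ?Q T (H \<inter> A T))"
  proof (intro rprob_mono ballI notI)
    fix H T assume H: "\<not> detour H x Y" and T: "T \<in> I"
      "H \<inter> A T \<inter> E T ` P2 \<noteq> {} \<and> H \<inter> A T \<inter> E T ` P3 \<noteq> {}"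
    then obtain a b where ab: "a \<in> P2" "b \<in> P3" "E T a \<in> H" "E T b \<in> H" by blast
    have "a \<noteq> b" using ab d by auto
    moreover have "a \<notin> insert x T" "b \<notin> insert x T" using I[OF T(1)] ab xP by auto
    moreover have "insert a (insert x T) \<inter> Y = {x}" "insert b (insert x T) \<inter> Y = {x}"
      using I(1)[OF T(1)] ab nY Y by blast+
    ultimately have "detour H x Y" using ab unfolding detour_def E_def
      by (intro exI[of _ "insert x T"] exI[of _ a] exI[of _ b]) simp
    then show False using H by simp
  qed
  also have "\<dots> = (\<Prod>T\<in>I. rprob D p (\<lambda>H. ?Q T (H \<inter> A T)))"
    using finD finI disj ED by (intro rprob_indep_family) (auto simp: A_def)
  also have "\<dots> = (\<Prod>T\<in>I. 1 - (1 - (1 - p) ^ h)\<^sup>2)"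
  proof (intro prod.cong refl)
    fix T assume T: "T \<in> I"
    have D23: "E T ` P2 \<subseteq> D" "E T ` P3 \<subseteq> D" using ED[OF T] by auto
    have c: "card (E T ` P2) = h" "card (E T ` P3) = h"
      using inj[OF T] P2 P3 by (auto simp: card_image inj_on_Un)
    have "E T ` P2 \<inter> E T ` P3 = E T ` (P2 \<inter> P3)"
      using inj[OF T] by (intro inj_on_image_Int[symmetric, of _ "P2 \<union> P3"]) auto
    then have disj: "E T ` P2 \<inter> E T ` P3 = {}" using d by simp
    have "rprob D p (\<lambda>H. ?Q T (H \<inter> A T)) = 1 - rprob D p (\<lambda>H. H \<inter> E T ` P2 \<noteq> {} \<and> H \<inter> E T ` P3 \<noteq> {})"
      unfolding rprob_not[symmetric] by (intro rprob_cong) (auto simp: A_def)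
    also have "rprob D p (\<lambda>H. H \<inter> E T ` P2 \<noteq> {} \<and> H \<inter> E T ` P3 \<noteq> {}) =
       rprob D p (\<lambda>H. H \<inter> E T ` P2 \<noteq> {}) * rprob D p (\<lambda>H. H \<inter> E T ` P3 \<noteq> {})"
      by (rule rprob_indep2'[where Q = "\<lambda>X. X \<noteq> {}" and R = "\<lambda>X. X \<noteq> {}", OF finD D23 disj])
    also have "\<dots> = (1 - (1 - p) ^ h)\<^sup>2"
      using finD D23 c p by (simp only: rprob_not rprob_disjnt power2_eq_square)
    finally show "rprob D p (\<lambda>H. ?Q T (H \<inter> A T)) = 1 - (1 - (1 - p) ^ h)\<^sup>2" .
  qed
  finally show ?thesis by (simp add: cardI)
qed

text \<open>The vertex part of the situation in which \<open>T_connectedI\<close> asks for a detour.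
  The presence of the edges is left out, so the set is deterministic and a union bound can run over
  it.\<close>

definition bad_configs :: "nat \<Rightarrow> nat \<Rightarrow> (nat \<times> nat \<times> nat \<times> nat set \<times> nat set) set" where
  "bad_configs k n = {(u, x, v, S, S'). u \<in> {1..n} \<and> x \<in> {1..n} \<and> v \<in> {1..n} \<and>
     S \<subseteq> {1..n} \<and> S' \<subseteq> {1..n} \<and> card S = k - 1 \<and> card S' = k - 1 \<and>
     u \<noteq> x \<and> x \<noteq> v \<and> u \<noteq> v \<and> u \<notin> S \<and> x \<notin> S \<and> x \<notin> S' \<and> v \<notin> S' \<and> S \<noteq> S' \<and> S \<inter> S' \<noteq> {}}"

lemma finite_bad_configs [simp]: "finite (bad_configs k n)"
  by (rule finite_subset[of _ "{1..n} \<times> {1..n} \<times> {1..n} \<times> Pow {1..n} \<times> Pow {1..n}"])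
     (clarsimp simp: bad_configs_def, simp_all)

text \<open>Naming a common vertex of \<open>S\<close> and \<open>S'\<close> costs a factor
  \<open>k\<close> and saves a factor \<open>n\<close>, which leaves
  \<open>3 + (k - 1) + (k - 2)\<close> free vertices. In the degenerate case \<open>v\<close> lies
  in \<open>S\<close> and \<open>S'\<close> is determined, so only \<open>u\<close>,
  \<open>x\<close> and \<open>S\<close> with the marked element \<open>v\<close> are free.\<close>

lemma card_bad_configs_le:
  assumes "k \<ge> 2"
  shows "card (bad_configs k n) \<le> k * n ^ (2 * k)"
    and "card {(u, x, v, S, S') \<in> bad_configs k n. insert u S = insert v S'} \<le> k * n ^ (k + 1)"
proof -
  let ?V = "{1..n}" and ?P = "\<lambda>j. {S. S \<subseteq> {1..n} \<and> card S = j}"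
  let ?Z = "SIGMA S:?P (k - 1). S"
  have finP: "finite (?P j)" for j by (rule finite_subset[of _ "Pow {1..n}"]) auto
  have finS: "finite S" if "S \<in> ?P j" for S j using that finite_subset[of S ?V] by auto
  have finZ: "finite ?Z" by (rule finite_SigmaI[OF finP finS])
  have "card ?Z = (\<Sum>S\<in>?P (k - 1). card S)" by (rule card_SigmaI[OF finP]) (use finS in blast)
  also have "\<dots> = card (?P (k - 1)) * (k - 1)" by simp
  also have "\<dots> \<le> n ^ (k - 1) * k" by (intro mult_mono card_subsets_le_power) auto
  finally have cardZ: "card ?Z \<le> n ^ (k - 1) * k" .
  let ?I = "?V \<times> ?V \<times> ?V \<times> ?Z \<times> ?P (k - 2)"
  let ?f = "\<lambda>(u :: nat, x :: nat, v :: nat, (S, z), R). (u, x, v, S, insert z R)"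
  have "bad_configs k n \<subseteq> ?f ` ?I"
  proof
    fix c assume "c \<in> bad_configs k n"
    moreover obtain u x v S S' where c: "c = (u, x, v, S, S')" by (cases c) auto
    ultimately have c: "c = (u, x, v, S, S')" "u \<in> ?V" "x \<in> ?V" "v \<in> ?V"
      "S \<subseteq> ?V" "S' \<subseteq> ?V" "card S = k - 1" "card S' = k - 1" "S \<inter> S' \<noteq> {}"
      unfolding bad_configs_def by simp_all
    then obtain z where z: "z \<in> S" "z \<in> S'" by blast
    have "card (S' - {z}) = k - 2" using z c finite_subset[of S' ?V] by simp
    then have "(u, x, v, (S, z), S' - {z}) \<in> ?I" using z c by auto
    moreover have "c = ?f (u, x, v, (S, z), S' - {z})" using z c by (simp add: insert_absorb)
    ultimately show "c \<in> ?f ` ?I" by (rule rev_image_eqI)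
  qed
  then have "card (bad_configs k n) \<le> card (?f ` ?I)"
    using finP finZ by (intro card_mono) auto
  also have "\<dots> \<le> card ?I" using finP finZ by (intro card_image_le) auto
  also have "\<dots> = n * (n * (n * (card ?Z * card (?P (k - 2)))))" by (simp only: card_cartesian_product) simp
  also have "\<dots> \<le> n * (n * (n * ((n ^ (k - 1) * k) * n ^ (k - 2))))"
    by (intro mult_mono cardZ card_subsets_le_power) auto
  also have "\<dots> = k * (n ^ 3 * n ^ (k - 1) * n ^ (k - 2))"
    by (simp add: power3_eq_cube algebra_simps)
  also have "n ^ 3 * n ^ (k - 1) * n ^ (k - 2) = n ^ (2 * k)"
    unfolding power_add[symmetric] using assms by (intro arg_cong[where f = "\<lambda>j. n ^ j"]) simp
  finally show "card (bad_configs k n) \<le> k * n ^ (2 * k)" .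
  let ?J = "?V \<times> ?V \<times> ?Z"
  let ?g = "\<lambda>(u :: nat, x :: nat, (S, v)). (u, x, v, S, insert u S - {v})"
  let ?C = "{(u, x, v, S, S') \<in> bad_configs k n. insert u S = insert v S'}"
  have "?C \<subseteq> ?g ` ?J"
  proof
    fix c assume "c \<in> ?C"
    moreover obtain u x v S S' where c: "c = (u, x, v, S, S')" by (cases c) auto
    ultimately have c: "c = (u, x, v, S, S')" "u \<in> ?V" "x \<in> ?V"
      "S \<subseteq> ?V" "card S = k - 1" "u \<noteq> v" "v \<notin> S'" "insert u S = insert v S'"
      unfolding bad_configs_def by simp_all
    have "v \<in> insert u S" unfolding c(8) by simp
    then have "v \<in> S" using c(6) by simp
    then have "(u, x, (S, v)) \<in> ?J" using c by simp
    moreover have "S' = insert u S - {v}" using c(7) unfolding c(8) by simp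
    then have "c = ?g (u, x, (S, v))" using c(1) by simp
    ultimately show "c \<in> ?g ` ?J" by (rule rev_image_eqI)
  qed
  then have "card ?C \<le> card (?g ` ?J)"
    using finZ by (intro card_mono) auto
  also have "\<dots> \<le> card ?J" using finZ by (intro card_image_le) auto
  also have "\<dots> = n * (n * card ?Z)" by (simp only: card_cartesian_product) simp
  also have "\<dots> \<le> n * (n * (n ^ (k - 1) * k))" by (intro mult_mono cardZ) auto
  also have "\<dots> = k * (n ^ 2 * n ^ (k - 1))" by (simp add: power2_eq_square algebra_simps)
  also have "n ^ 2 * n ^ (k - 1) = n ^ (k + 1)"
    unfolding power_add[symmetric] using assms by (intro arg_cong[where f = "\<lambda>j. n ^ j"]) simp
  finally show "card ?C \<le> k * n ^ (k + 1)" .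
qed

text \<open>Degenerate configurations with \<open>insert u S = insert v S'\<close> consist of three edges and are too
  rare to occur at all. The others have four edges, and their expected number is only polylogarithmic.\<close>

lemma rprob_bad_config_le:
  fixes n k h :: nat
  defines "D \<equiv> possible_edges k n"
  assumes k: "k \<ge> 2" and p: "0 \<le> p" "p \<le> 1" and h: "3 * h + 4 * k \<le> n"
  shows "rprob D p (\<lambda>H. \<exists>(u, x, v, S, S')\<in>bad_configs k n.
            {insert u S, insert x S, insert x S', insert v S'} \<subseteq> H \<and> \<not> detour H x ({u, x, v} \<union> S \<union> S'))
     \<le> k * real n ^ (k + 1) * p ^ 3 +
        k * real n ^ (2 * k) * (p ^ 4 * (1 - (1 - (1 - p) ^ h)\<^sup>2) ^ (h choose (k - 2)))"
proof -
  let ?r = "(1 - (1 - (1 - p) ^ h)\<^sup>2) ^ (h choose (k - 2))"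
  let ?C = "bad_configs k n"
  let ?C3 = "{(u, x, v, S, S') \<in> ?C. insert u S = insert v S'}"
  define Z where "Z = (\<lambda>(u :: nat, x :: nat, v :: nat, S, S'). {insert u S, insert x S, insert x S', insert v S'})"
  define B where "B = (\<lambda>(u :: nat, x :: nat, v :: nat, S, S') H. \<not> detour H x ({u, x, v} \<union> S \<union> S'))"
  have finD: "finite D" unfolding D_def by simp
  have r: "0 \<le> ?r"
  proof -
    have "0 \<le> 1 - (1 - p) ^ h" "1 - (1 - p) ^ h \<le> 1" using p by (auto intro: power_le_one)
    then have "(1 - (1 - p) ^ h)\<^sup>2 \<le> 1" by (intro power_le_one) auto
    then show ?thesis by (intro zero_le_power) auto
  qed
  \<comment> \<open>Three of the edges are distinct in every configuration. This bound drops the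
    detour condition and is spent on the degenerate configurations only.\<close>
  have C3: "rprob D p (\<lambda>H. Z c \<subseteq> H \<and> B c H) \<le> p ^ 3" if "c \<in> ?C" for c
  proof -
    obtain u x v S S' where c: "c = (u, x, v, S, S')" by (cases c) auto
    have cc: "u \<noteq> x" "x \<notin> S" "x \<notin> S'" "S \<noteq> S'" "u \<notin> S" using that unfolding c bad_configs_def by auto
    let ?Z = "{insert u S, insert x S, insert x S'}"
    have "x \<notin> insert u S" using cc by simp
    then have "insert u S \<noteq> insert x S" "insert u S \<noteq> insert x S'" by (metis insertI1)+
    moreover have "insert x S \<noteq> insert x S'" using cc by (simp add: insert_ident)
    ultimately have 3: "card ?Z = 3" by simp
    show ?thesis
    proof (cases "?Z \<subseteq> D")
      case True
      have "rprob D p (\<lambda>H. Z c \<subseteq> H \<and> B c H) \<le> rprob D p (\<lambda>H. ?Z \<subseteq> H)"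
        unfolding c Z_def by (intro rprob_mono) auto
      also have "\<dots> = p ^ 3" using rprob_superset[OF finD True p] 3 by simp
      finally show ?thesis .
    next
      case False
      have "rprob D p (\<lambda>H. Z c \<subseteq> H \<and> B c H) \<le> rprob D p (\<lambda>H. False)"
        using False unfolding c Z_def by (intro rprob_mono) auto
      then show ?thesis using p by (auto intro: order.trans)
    qed
  qed
  have C4: "rprob D p (\<lambda>H. Z c \<subseteq> H \<and> B c H) \<le> p ^ 4 * ?r" if "c \<in> ?C - ?C3" for c
  proof -
    obtain u x v S S' where c: "c = (u, x, v, S, S')" by (cases c) auto
    have m: "(u, x, v, S, S') \<in> ?C" "insert u S \<noteq> insert v S'" using that unfolding c by simp_all
    then have cc: "u \<noteq> x" "x \<noteq> v" "x \<notin> S" "x \<notin> S'" "S \<noteq> S'" "u \<notin> S" "v \<notin> S'" "insert u S \<noteq> insert v S'"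
      "u \<in> {1..n}" "x \<in> {1..n}" "v \<in> {1..n}" "S \<subseteq> {1..n}" "S' \<subseteq> {1..n}" "card S = k - 1" "card S' = k - 1"
      unfolding bad_configs_def by simp_all
    have fin: "finite S" "finite S'" using cc finite_subset by auto
    \<comment> \<open>Membership of \<open>x\<close> separates the outer two edges from the inner
      two, and \<open>S \<noteq> S'\<close> separates the inner ones; only the outer two could
      coincide.\<close>
    have "x \<notin> insert u S" "x \<notin> insert v S'" using cc by simp_all
    then have "insert u S \<noteq> insert x S" "insert u S \<noteq> insert x S'" "insert x S \<noteq> insert v S'"
         "insert x S' \<noteq> insert v S'" by (metis insertI1)+
    moreover have "insert x S \<noteq> insert x S'" using cc by (simp add: insert_ident)
    ultimately have 4: "card (Z c) = 4" unfolding c Z_def using cc(8) by simp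
    have ZD: "Z c \<subseteq> D" unfolding c Z_def D_def possible_edges_def using cc fin k by auto
    let ?Y = "{u, x, v} \<union> S \<union> S'"
    have Y: "?Y \<subseteq> {1..n}" "x \<in> ?Y" using cc by auto
    have "card ?Y \<le> card {u, x, v} + card S + card S'"
      by (intro order.trans[OF card_Un_le] add_mono) auto
    moreover have "card {u, x, v} \<le> 3" by (simp add: card_insert_if)
    ultimately have "card ?Y \<le> 4 * k" using cc(14,15) k by linarith
    then have hY: "3 * h + card ?Y \<le> n" using h by linarith
    \<comment> \<open>Edges of a detour meet \<open>?Y\<close> in \<open>x\<close> alone, whereas
      those of \<open>Z c\<close> lie inside \<open>?Y\<close> and have more than one vertex.
      Avoiding all of \<open>?Y\<close>, beyond the two edges at \<open>x\<close>, is what makes the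
      detour independent of the configuration.\<close>
    define A where "A = {F \<in> D. F \<inter> ?Y = {x}}"
    have AZ: "A \<inter> Z c = {}"
    proof (rule equals0I)
      fix F assume F: "F \<in> A \<inter> Z c"
      then have "F \<subseteq> ?Y" unfolding c Z_def by auto
      then have "F = {x}" using F unfolding A_def by auto
      moreover have "card F = k" using F unfolding A_def D_def possible_edges_def by simp
      ultimately show False using k by simp
    qed
    have det: "detour H x ?Y \<longleftrightarrow> detour (H \<inter> A) x ?Y" if "H \<subseteq> D" for H
    proof -
      have "insert a T \<in> H \<inter> A \<and> insert a T \<inter> ?Y = {x} \<longleftrightarrow> insert a T \<in> H \<and> insert a T \<inter> ?Y = {x}" for a T
        using that unfolding A_def by auto
      then show ?thesis unfolding detour_def by metis
    qed
    have "rprob D p (\<lambda>H. Z c \<subseteq> H \<and> B c H) = rprob D p (\<lambda>H. \<not> detour (H \<inter> A) x ?Y \<and> Z c \<subseteq> H \<inter> Z c)"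
      using det unfolding c B_def by (intro rprob_cong) auto
    also have "\<dots> = rprob D p (\<lambda>H. \<not> detour (H \<inter> A) x ?Y) * rprob D p (\<lambda>H. Z c \<subseteq> H \<inter> Z c)"
      by (rule rprob_indep2'[where Q = "\<lambda>X. \<not> detour X x ?Y" and R = "\<lambda>X. Z c \<subseteq> X", OF finD _ ZD AZ])
         (simp add: A_def)
    also have "rprob D p (\<lambda>H. \<not> detour (H \<inter> A) x ?Y) = rprob D p (\<lambda>H. \<not> detour H x ?Y)"
      using det by (intro rprob_cong) auto
    also have "rprob D p (\<lambda>H. Z c \<subseteq> H \<inter> Z c) = p ^ 4"
      using rprob_superset[OF finD ZD p] 4 by simp
    also have "rprob D p (\<lambda>H. \<not> detour H x ?Y) * p ^ 4 \<le> ?r * p ^ 4"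
      unfolding D_def using k p Y hY by (intro mult_right_mono rprob_no_detour_le) auto
    finally show ?thesis by (simp only: mult.commute)
  qed
  have "rprob D p (\<lambda>H. \<exists>(u, x, v, S, S')\<in>?C.
            {insert u S, insert x S, insert x S', insert v S'} \<subseteq> H \<and> \<not> detour H x ({u, x, v} \<union> S \<union> S'))
     = rprob D p (\<lambda>H. \<exists>c\<in>?C. Z c \<subseteq> H \<and> B c H)"
    unfolding Z_def B_def by (intro rprob_cong bex_cong refl) (auto split: prod.splits)
  also have "\<dots> \<le> (\<Sum>c\<in>?C. rprob D p (\<lambda>H. Z c \<subseteq> H \<and> B c H))"
    by (rule rprob_ex_le) simp
  also have "\<dots> = (\<Sum>c\<in>?C3. rprob D p (\<lambda>H. Z c \<subseteq> H \<and> B c H)) + (\<Sum>c\<in>?C - ?C3. rprob D p (\<lambda>H. Z c \<subseteq> H \<and> B c H))"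
    by (subst sum.subset_diff[of ?C3 ?C]) (auto simp: add.commute)
  also have "\<dots> \<le> (\<Sum>c\<in>?C3. p ^ 3) + (\<Sum>c\<in>?C - ?C3. p ^ 4 * ?r)"
    by (intro add_mono sum_mono C3 C4) auto
  also have "\<dots> = real (card ?C3) * p ^ 3 + real (card (?C - ?C3)) * (p ^ 4 * ?r)" by simp
  also have "\<dots> \<le> (k * real n ^ (k + 1)) * p ^ 3 + (k * real n ^ (2 * k)) * (p ^ 4 * ?r)"
  proof (intro add_mono mult_right_mono)
    show "real (card ?C3) \<le> k * real n ^ (k + 1)"
      using of_nat_mono[OF card_bad_configs_le(2)[OF k, of n], where 'a = real]
      by (simp only: of_nat_mult of_nat_power)
    have "card (?C - ?C3) \<le> card ?C" by (intro card_mono) auto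
    then have "card (?C - ?C3) \<le> k * n ^ (2 * k)" using card_bad_configs_le(1)[OF k, of n] by linarith
    from of_nat_mono[OF this, where 'a = real] show "real (card (?C - ?C3)) \<le> k * real n ^ (2 * k)"
      by (simp only: of_nat_mult of_nat_power)
  qed (use p r in auto)
  finally show ?thesis .
qed

section \<open>Above the threshold: no cut in the adjacency graph\<close>

lemma sum_power_card_Pow:
  fixes r :: real
  assumes "finite V"
  shows "(\<Sum>A\<in>Pow V. r ^ card A) = (1 + r) ^ card V"
  using assms
proof (induction V rule: finite_induct)
  case (insert x V)
  have "(\<Sum>A\<in>Pow (insert x V). r ^ card A) = (\<Sum>A\<in>Pow V. r ^ card A) + (\<Sum>A\<in>insert x ` Pow V. r ^ card A)"
    unfolding Pow_insert using insert.hyps by (intro sum.union_disjoint) auto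
  also have "(\<Sum>A\<in>insert x ` Pow V. r ^ card A) = (\<Sum>A\<in>Pow V. r ^ card (insert x A))"
    using insert.hyps by (subst sum.reindex) (auto simp: inj_on_def insert_ident subset_iff)
  also have "\<dots> = (\<Sum>A\<in>Pow V. r * r ^ card A)"
  proof (intro sum.cong refl)
    fix A assume "A \<in> Pow V"
    then have "x \<notin> A" "finite A" using insert.hyps finite_subset by auto
    then show "r ^ card (insert x A) = r * r ^ card A" by simp
  qed
  finally show ?case using insert by (simp add: sum_distrib_left[symmetric] algebra_simps)
qed simp

text \<open>Each factor of the falling factorial is at least \<open>n - k\<close>; for
  \<open>k > n\<close> truncated subtraction makes the left side vanish.\<close>

lemma power_le_fact_mult_binomial: "(n - k) ^ k \<le> fact k * (n choose k)"
proof (induction k)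
  case (Suc k)
  have "(n - Suc k) ^ Suc k \<le> (n - k) * (n - k) ^ k"
    unfolding power_Suc by (intro mult_mono power_mono) auto
  also have "\<dots> \<le> (n - k) * (fact k * (n choose k))" using Suc by (intro mult_left_mono) auto
  also have "\<dots> = fact k * ((n - k) * (n choose k))" by simp
  also have "(n - k) * (n choose k) = Suc k * (n choose Suc k)"
    by (metis binomial_absorb_comp binomial_absorption mult.commute)
  finally show ?case by (simp add: algebra_simps)
qed simp

text \<open>A first moment bound: at most \<open>n^(k+1)\<close> triples, each asking for two
  distinct edges.\<close>

lemma rprob_cherries_ge_le:
  fixes n k :: nat
  defines "D \<equiv> possible_edges k n"
  defines "I \<equiv> {S. S \<subseteq> {1..n} \<and> card S = k - 1} \<times> {1..n} \<times> {1..n}"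
  assumes k: "k \<ge> 1" and p: "0 \<le> p" "p \<le> 1" and M: "M > 0"
  shows "rprob D p (\<lambda>H. real (card {(S, x, y) \<in> I. x \<noteq> y \<and> x \<notin> S \<and> y \<notin> S \<and> insert x S \<in> H \<and> insert y S \<in> H}) \<ge> M)
     \<le> real n ^ (k + 1) * p\<^sup>2 / M"
proof -
  let ?P = "{S. S \<subseteq> {1..n} \<and> card S = k - 1}"
  have finD: "finite D" unfolding D_def by simp
  have finP: "finite ?P" by (rule finite_subset[of _ "Pow {1..n}"]) auto
  then have finI: "finite I" unfolding I_def by simp
  define Q where "Q = (\<lambda>(S, x, y :: nat) H. x \<noteq> y \<and> x \<notin> S \<and> y \<notin> S \<and> insert x S \<in> H \<and> insert y S \<in> H)"
  have "rprob D p (\<lambda>H. real (card {i \<in> I. Q i H}) \<ge> M) \<le> (\<Sum>i\<in>I. rprob D p (Q i)) / M"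
    by (rule rprob_card_ge_le[OF finD finI M])
  also have "\<dots> \<le> real n ^ (k + 1) * p\<^sup>2 / M"
  proof (intro divide_right_mono)
    have "(\<Sum>i\<in>I. rprob D p (Q i)) \<le> (\<Sum>i\<in>I. p\<^sup>2)"
    proof (intro sum_mono)
      fix i assume "i \<in> I"
      obtain S x y where i: "i = (S, x, y)" by (cases i) auto
      let ?Z = "{insert x S, insert y S}"
      show "rprob D p (Q i) \<le> p\<^sup>2"
      proof (cases "x \<noteq> y \<and> x \<notin> S \<and> y \<notin> S \<and> ?Z \<subseteq> D")
        case True
        then have "x \<notin> insert y S" by simp
        then have "insert x S \<noteq> insert y S" by (metis insertI1)
        then have 2: "card ?Z = 2" by simp
        have "rprob D p (Q i) \<le> rprob D p (\<lambda>H. ?Z \<subseteq> H)"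
          unfolding i Q_def by (intro rprob_mono) auto
        also have "\<dots> = p\<^sup>2" using rprob_superset[of D ?Z p] finD True p 2 by simp
        finally show ?thesis .
      next
        case False
        have "rprob D p (Q i) \<le> rprob D p (\<lambda>H. False)"
          using False unfolding i Q_def by (intro rprob_mono) auto
        then show ?thesis using p by (auto intro: order.trans)
      qed
    qed
    also have "\<dots> = real (card I) * p\<^sup>2" by simp
    also have "\<dots> \<le> real n ^ (k + 1) * p\<^sup>2"
    proof (intro mult_right_mono)
      have "card I = card ?P * (n * n)" unfolding I_def by (simp only: card_cartesian_product) simp
      also have "\<dots> \<le> n ^ (k - 1) * (n * n)" by (intro mult_right_mono card_subsets_le_power) auto
      also have "\<dots> = n ^ (k - 1) * n ^ 2" by (simp add: power2_eq_square)
      also have "\<dots> = n ^ (k + 1)"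
        unfolding power_add[symmetric] using k by (intro arg_cong[where f = "\<lambda>j. n ^ j"]) simp
      finally show "real (card I) \<le> real n ^ (k + 1)" by (metis of_nat_mono of_nat_power)
    qed auto
    finally show "(\<Sum>i\<in>I. rprob D p (Q i)) \<le> real n ^ (k + 1) * p\<^sup>2" .
  qed (use M in auto)
  also have "rprob D p (\<lambda>H. real (card {i \<in> I. Q i H}) \<ge> M) =
     rprob D p (\<lambda>H. real (card {(S, x, y) \<in> I. x \<noteq> y \<and> x \<notin> S \<and> y \<notin> S \<and> insert x S \<in> H \<and> insert y S \<in> H}) \<ge> M)"
    unfolding Q_def by (intro rprob_cong) (simp add: case_prod_unfold)
  finally show ?thesis .
qed

text \<open>The edges outside \<open>A\<close> are exposed first. An unexposed edge made of a vertex
  of \<open>A\<close> and a set of their shadow would join \<open>A\<close> to its complement, so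
  all of these must be absent. The size of the shadow is part of the event, hence the bound holds
  for every outcome of the first round.\<close>

lemma rprob_no_crossing_le:
  fixes n k :: nat and A :: "nat set"
  defines "D \<equiv> possible_edges k n"
  defines "DB \<equiv> {e \<in> D. e \<subseteq> {1..n} - A}"
  assumes k: "k \<ge> 1" and p: "0 \<le> p" "p \<le> 1" and A: "A \<subseteq> {1..n}"
  shows "rprob D p (\<lambda>H. real (card (shadow (H \<inter> DB))) \<ge> m \<and> (\<forall>x\<in>A. \<forall>y\<in>{1..n} - A. \<not> adj H x y))
     \<le> exp (- (p * real (card A) * m))"
proof -
  let ?R = "{e \<in> D. \<not> e \<subseteq> {1..n} - A}"
  have fin: "finite D" "finite DB" "finite ?R" unfolding D_def DB_def by auto
  have AB: "DB \<union> ?R = D" "DB \<inter> ?R = {}" unfolding DB_def by auto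
  have finA: "finite A" using A finite_subset by auto
  let ?Q = "\<lambda>G Y. real (card (shadow G)) \<ge> m \<and> (\<forall>x\<in>A. \<forall>S\<in>shadow G. insert x S \<notin> Y)"
  have "rprob D p (\<lambda>H. real (card (shadow (H \<inter> DB))) \<ge> m \<and> (\<forall>x\<in>A. \<forall>y\<in>{1..n} - A. \<not> adj H x y))
     \<le> rprob D p (\<lambda>H. ?Q (H \<inter> DB) (H \<inter> ?R))"
  proof (intro rprob_mono conjI ballI notI)
    fix H x S
    assume H: "real (card (shadow (H \<inter> DB))) \<ge> m \<and> (\<forall>x\<in>A. \<forall>y\<in>{1..n} - A. \<not> adj H x y)"
      and x: "x \<in> A" and S: "S \<in> shadow (H \<inter> DB)" "insert x S \<in> H \<inter> ?R"
    from S(1) obtain y where y: "y \<notin> S" "insert y S \<in> H \<inter> DB" unfolding shadow_def by blast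
    have sub: "insert y S \<subseteq> {1..n} - A" using y(2) unfolding DB_def by simp
    then have "x \<notin> S" "x \<noteq> y" "y \<in> {1..n} - A" using x by auto
    moreover from this have "adj H x y" unfolding adj_def using y S(2) by blast
    ultimately show False using H x by blast
  qed auto
  also have "\<dots> \<le> exp (- (p * real (card A) * m))"
  proof -
    have "rprob ?R p (?Q G) \<le> exp (- (p * real (card A) * m))" if G: "G \<subseteq> DB" for G
    proof (cases "real (card (shadow G)) \<ge> m")
      case False
      then show ?thesis by simp
    next
      case True
      have Ge: "e \<subseteq> {1..n} - A \<and> finite e \<and> card e = k" if "e \<in> G" for e
        using that G possible_edgesD[of e k n] unfolding D_def DB_def by blast
      have finG: "finite G" using G fin finite_subset by blast
      have finsh: "finite (shadow G)" using card_shadow_le(1)[of G k] finG Ge by auto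
      have S: "S \<subseteq> {1..n} - A \<and> finite S \<and> card S = k - 1" if "S \<in> shadow G" for S
      proof -
        from that obtain y where "y \<notin> S" "insert y S \<in> G" unfolding shadow_def by blast
        then show ?thesis using Ge[of "insert y S"] by auto
      qed
      define X where "X = (\<lambda>(x, S). insert x S) ` (A \<times> shadow G)"
      \<comment> \<open>\<open>S\<close> avoids \<open>A\<close>, so \<open>x\<close> is the only
        vertex of \<open>insert x S\<close> in \<open>A\<close> and both can be read off the
        edge.\<close>
      have inj: "inj_on (\<lambda>(x, S). insert x S) (A \<times> shadow G)"
      proof (rule inj_onI, clarify)
        fix x S x' S' assume h: "x \<in> A" "S \<in> shadow G" "x' \<in> A" "S' \<in> shadow G" "insert x S = insert x' S'"
        have "x \<notin> S" "x \<notin> S'" "x' \<notin> S" "x' \<notin> S'" using S[OF h(2)] S[OF h(4)] h(1,3) by auto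
        moreover from this have "x = x'" using h(5) by (metis insertE insertI1)
        ultimately show "x = x' \<and> S = S'" using h(5) by (simp add: insert_ident)
      qed
      have XR: "X \<subseteq> ?R"
      proof
        fix e assume "e \<in> X"
        then obtain x T where e: "e = insert x T" "x \<in> A" "T \<in> shadow G" unfolding X_def by auto
        have "x \<notin> T" using S[OF e(3)] e(2) by auto
        then have "card e = k" using S[OF e(3)] k e(1) by simp
        moreover have "e \<subseteq> {1..n}" using S[OF e(3)] e A by auto
        ultimately show "e \<in> ?R" using e by (auto simp: D_def possible_edges_def)
      qed
      have "rprob ?R p (?Q G) = rprob ?R p (\<lambda>Y. Y \<inter> X = {})"
        using True by (intro rprob_cong) (auto simp: X_def)
      also have "\<dots> = (1 - p) ^ card X" by (rule rprob_disjnt[OF fin(3) XR p])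
      also have "\<dots> \<le> exp (- p) ^ card X"
        using p exp_ge_add_one_self[of "- p"] by (intro power_mono) auto
      also have "\<dots> = exp (- (p * real (card X)))"
        by (simp add: exp_of_nat_mult[symmetric] mult.commute)
      also have "card X = card A * card (shadow G)"
        unfolding X_def using inj by (simp add: card_image card_cartesian_product)
      also have "exp (- (p * real (card A * card (shadow G)))) \<le> exp (- (p * real (card A) * m))"
        using True p by (simp add: mult_left_mono mult.assoc)
      finally show ?thesis .
    qed
    from rprob_cond_le[OF fin(2,3) AB(2), of p ?Q, OF this] show ?thesis unfolding AB(1) .
  qed
  finally show ?thesis .
qed

text \<open>A cut needs one of three failures: many overlapping pairs of edges, few edges outside
  some \<open>A\<close>, or a large shadow without a crossing edge. The first is counted in the
  whole hypergraph and covers all \<open>A\<close> at once, so its weak Markov bound is not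
  multiplied by the number of sets; only the exponentially small bounds are summed.\<close>

lemma rprob_cut_le:
  fixes n k :: nat
  defines "D \<equiv> possible_edges k n"
  defines "\<A> \<equiv> {A. A \<subseteq> {1..n} \<and> A \<noteq> {} \<and> 2 * card A \<le> n}"
  assumes k: "k \<ge> 1" and p: "0 \<le> p" "p \<le> 1" and M: "M > 0" and \<eta>: "0 < \<eta>" "\<eta> \<le> 1"
  shows "rprob D p (\<lambda>H. \<exists>A\<in>\<A>. \<forall>x\<in>A. \<forall>y\<in>{1..n} - A. \<not> adj H x y)
     \<le> real n ^ (k + 1) * p\<^sup>2 / M +
        (\<Sum>A\<in>\<A>. exp (- (\<eta> ^ 3 / 2 * (real (n - card A choose k) * p))) +
                 exp (- (p * real (card A) * (real k * ((1 - \<eta>) * (real (n - card A choose k) * p)) - M))))"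
proof -
  define I where "I = {S. S \<subseteq> {1..n} \<and> card S = k - 1} \<times> {1..n} \<times> {1..n}"
  let ?ch = "\<lambda>H. {(S, x, y) \<in> I. x \<noteq> y \<and> x \<notin> S \<and> y \<notin> S \<and> insert x S \<in> H \<and> insert y S \<in> H}"
  define DB where "DB A = {e \<in> D. e \<subseteq> {1..n} - A}" for A :: "nat set"
  define g where "g A = (1 - \<eta>) * (real (n - card A choose k) * p)" for A :: "nat set"
  let ?cut = "\<lambda>A H. \<forall>x\<in>A. \<forall>y\<in>{1..n} - A. \<not> adj H x y"
  have finD: "finite D" unfolding D_def by simp
  have fin\<A>: "finite \<A>" unfolding \<A>_def by (rule finite_subset[of _ "Pow {1..n}"]) auto
  have finI: "finite I" unfolding I_def by (rule finite_subset[of _ "Pow {1..n} \<times> {1..n} \<times> {1..n}"]) auto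
  let ?small = "\<lambda>A H. real (card (H \<inter> DB A)) \<le> g A"
  let ?nocross = "\<lambda>A H. real (card (shadow (H \<inter> DB A))) \<ge> real k * g A - M \<and> ?cut A H"
  have "rprob D p (\<lambda>H. \<exists>A\<in>\<A>. ?cut A H) \<le>
     rprob D p (\<lambda>H. real (card (?ch H)) \<ge> M \<or> (\<exists>A\<in>\<A>. ?small A H \<or> ?nocross A H))"
  proof (intro rprob_mono)
    fix H assume H: "H \<subseteq> D" "\<exists>A\<in>\<A>. ?cut A H"
    then obtain A where A: "A \<in> \<A>" "?cut A H" by blast
    show "real (card (?ch H)) \<ge> M \<or> (\<exists>A\<in>\<A>. ?small A H \<or> ?nocross A H)"
    proof (cases "real (card (?ch H)) \<ge> M \<or> ?small A H")
      case True
      then show ?thesis using A by blast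
    next
      case False
      let ?G = "H \<inter> DB A"
      have He: "e \<subseteq> {1..n} \<and> finite e \<and> card e = k" if "e \<in> H" for e
        using that H possible_edgesD[of e k n] unfolding D_def by blast
      have ch: "{(S, x, y). x \<noteq> y \<and> x \<notin> S \<and> y \<notin> S \<and> insert x S \<in> ?G \<and> insert y S \<in> ?G} \<subseteq> ?ch H"
      proof clarify
        fix S x y assume S: "x \<noteq> y" "x \<notin> S" "y \<notin> S" "insert x S \<in> H" "insert y S \<in> H"
        have "insert x S \<subseteq> {1..n}" "finite S" "card S = k - 1" "y \<in> {1..n}"
          using He[OF S(4)] He[OF S(5)] S(2) by auto
        then show "(S, x, y) \<in> I \<and> x \<noteq> y \<and> x \<notin> S \<and> y \<notin> S \<and> insert x S \<in> H \<and> insert y S \<in> H"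
          using S unfolding I_def by simp
      qed
      have "k * card ?G \<le> card (shadow ?G) + card (?ch H)"
      proof (rule card_cherries_le[OF _ _ _ ch])
        show "finite ?G" using finD by (auto simp: DB_def)
        show "finite e \<and> card e = k" if "e \<in> ?G" for e using He that by blast
        show "finite (?ch H)" using finI by (rule rev_finite_subset) auto
      qed
      from of_nat_mono[OF this, where 'a = real]
      have "real (k * card ?G) \<le> real (card (shadow ?G)) + real (card (?ch H))"
        by (simp only: of_nat_add)
      moreover have "real k * g A \<le> real (k * card ?G)" using False by (simp add: mult_left_mono)
      moreover have "real (card (?ch H)) < M" using False by simp
      ultimately have "real k * g A - M \<le> real (card (shadow ?G))" by linarith
      then have "?nocross A H" using A(2) by (intro conjI)
      then show ?thesis using A by blast
    qed
  qed
  also have "\<dots> \<le> rprob D p (\<lambda>H. real (card (?ch H)) \<ge> M) + rprob D p (\<lambda>H. \<exists>A\<in>\<A>. ?small A H \<or> ?nocross A H)"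
    by (rule rprob_Un_le)
  also have "\<dots> \<le> real n ^ (k + 1) * p\<^sup>2 / M +
        (\<Sum>A\<in>\<A>. exp (- (\<eta> ^ 3 / 2 * (real (n - card A choose k) * p))) +
                 exp (- (p * real (card A) * (real k * g A - M))))"
  proof (intro add_mono)
    show "rprob D p (\<lambda>H. real (card (?ch H)) \<ge> M) \<le> real n ^ (k + 1) * p\<^sup>2 / M"
      unfolding D_def I_def using k p M by (rule rprob_cherries_ge_le)
    have "rprob D p (\<lambda>H. \<exists>A\<in>\<A>. ?small A H \<or> ?nocross A H) \<le> (\<Sum>A\<in>\<A>. rprob D p (\<lambda>H. ?small A H \<or> ?nocross A H))"
      by (rule rprob_ex_le[OF fin\<A>])
    also have "\<dots> \<le> (\<Sum>A\<in>\<A>. exp (- (\<eta> ^ 3 / 2 * (real (n - card A choose k) * p))) +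
                 exp (- (p * real (card A) * (real k * g A - M))))"
    proof (intro sum_mono order.trans[OF rprob_Un_le] add_mono)
      fix A assume "A \<in> \<A>"
      then have A: "A \<subseteq> {1..n}" by (simp add: \<A>_def)
      show "rprob D p (?nocross A) \<le> exp (- (p * real (card A) * (real k * g A - M)))"
        unfolding D_def DB_def using k p A by (rule rprob_no_crossing_le)
      let ?N = "real (n - card A choose k)"
      have "card ({1..n} - A) = n - card A" using A finite_subset[OF A] by (simp add: card_Diff_subset)
      moreover have "DB A = {e. e \<subseteq> {1..n} - A \<and> card e = k}"
        unfolding DB_def D_def possible_edges_def by auto
      ultimately have cDB: "card (DB A) = (n - card A) choose k"
        using n_subsets[of "{1..n} - A" k] by simp
      have finDB: "finite (DB A)" using finD by (simp add: DB_def)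
      have "rprob D p (?small A) = rprob (DB A) p (\<lambda>G. real (card G) \<le> g A)"
        using finD by (rule rprob_restrict) (auto simp: DB_def)
      \<comment> \<open>Multiplying by the negative parameter \<open>- \<eta>\<close> reverses the
        inequality and turns the lower tail into the form of the Chernoff bound.\<close>
      also have "\<dots> = rprob (DB A) p (\<lambda>G. (- \<eta>) * real (card G) \<ge> (- \<eta>) * g A)"
        using \<eta> by (intro rprob_cong) auto
      also have "\<dots> \<le> exp (real (card (DB A)) * p * (exp (- \<eta>) - 1) - (- \<eta>) * g A)"
        by (rule rprob_chernoff[OF finDB p])
      also have "\<dots> \<le> exp (- (\<eta> ^ 3 / 2 * (?N * p)))"
      proof (subst exp_le_cancel_iff)
        \<comment> \<open>Sharp enough to keep the cubic gain: the first and second order terms in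
          \<open>\<eta>\<close> cancel and \<open>- (\<eta> ^ 3 / (1 + \<eta>))\<close>
          remains.\<close>
        have e: "exp (- \<eta>) - 1 \<le> 1 / (1 + \<eta>) - 1"
          using \<eta> exp_ge_add_one_self[of \<eta>] by (simp add: exp_minus field_simps)
        have "real (card (DB A)) * p * (exp (- \<eta>) - 1) - (- \<eta>) * g A =
            (?N * p) * ((exp (- \<eta>) - 1) + \<eta> * (1 - \<eta>))"
          unfolding cDB g_def by (simp add: algebra_simps)
        also have "\<dots> \<le> (?N * p) * (- (\<eta> ^ 3 / 2))"
        proof (intro mult_left_mono)
          have "(1 / (1 + \<eta>) - 1) + \<eta> * (1 - \<eta>) = - (\<eta> ^ 3 / (1 + \<eta>))"
            using \<eta> by (simp add: field_simps power3_eq_cube)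
          also have "\<dots> \<le> - (\<eta> ^ 3 / 2)"
            using \<eta> by (subst neg_le_iff_le, intro divide_left_mono) auto
          finally show "(exp (- \<eta>) - 1) + \<eta> * (1 - \<eta>) \<le> - (\<eta> ^ 3 / 2)" using e by linarith
        qed (use p in auto)
        also have "\<dots> = - (\<eta> ^ 3 / 2 * (?N * p))" by (simp only: mult_minus_right mult.commute)
        finally show "real (card (DB A)) * p * (exp (- \<eta>) - 1) - (- \<eta>) * g A \<le> - (\<eta> ^ 3 / 2 * (?N * p))" .
      qed
      finally show "rprob D p (?small A) \<le> exp (- (\<eta> ^ 3 / 2 * (?N * p)))" .
    qed
    finally show "rprob D p (\<lambda>H. \<exists>A\<in>\<A>. ?small A H \<or> ?nocross A H) \<le> \<dots>" .
  qed
  finally show ?thesis unfolding g_def .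
qed

section \<open>Limits above the threshold\<close>

lemma tendsto_trail_threshold_times:
  assumes "k \<ge> 3"
  shows "(\<lambda>n. trail_threshold k n * (real n * (ln (real n))\<^sup>2)) \<longlonglongrightarrow> 0"
proof (rule tendsto_sandwich[OF _ _ tendsto_const])
  define c :: real where "c = fact (k - 1)"
  have "c > 0" unfolding c_def by simp
  then show "(\<lambda>n. sqrt (c * ln (real n) / real n ^ 3) * (real n * (ln (real n))\<^sup>2)) \<longlonglongrightarrow> 0" by real_asymp
  show "\<forall>\<^sub>F n in sequentially. trail_threshold k n * (real n * (ln (real n))\<^sup>2) \<le>
      sqrt (c * ln (real n) / real n ^ 3) * (real n * (ln (real n))\<^sup>2)"
    using eventually_ge_at_top[of 1]
  proof eventually_elim
    case (elim n)
    \<comment> \<open>From \<open>k \<ge> 3\<close> the threshold is at most of order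
      \<open>n powr (- 3 / 2)\<close> up to logarithms, which beats the factor
      \<open>n\<close>.\<close>
    then have "real n ^ 3 \<le> real n ^ k" using assms by (intro power_increasing) auto
    then show ?case unfolding trail_threshold_def c_def using elim
      by (intro mult_right_mono real_sqrt_le_mono divide_left_mono) auto
  qed
qed auto

lemma real_power_le_fact_mult_binomial:
  assumes "0 \<le> y" "y \<le> real n - real k"
  shows "y ^ k \<le> fact k * real (n choose k)"
proof -
  have "y ^ k \<le> real (n - k) ^ k" using assms by (intro power_mono) auto
  also have "\<dots> \<le> fact k * real (n choose k)"
    using of_nat_mono[OF power_le_fact_mult_binomial[of n k], where 'a = real] by simp
  finally show ?thesis .
qed

lemma rprob_cut_tendsto_0:
  fixes k :: nat and \<epsilon> :: real
  assumes k: "k \<ge> 3" and e: "0 < \<epsilon>" "\<epsilon> \<le> 1"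
  defines "p \<equiv> \<lambda>n. (1 + \<epsilon>) * trail_threshold k n"
  shows "(\<lambda>n. rprob (possible_edges k n) (p n)
      (\<lambda>H. \<exists>A\<in>{A. A \<subseteq> {1..n} \<and> A \<noteq> {} \<and> 2 * card A \<le> n}. \<forall>x\<in>A. \<forall>y\<in>{1..n} - A. \<not> adj H x y)) \<longlonglongrightarrow> 0"
proof (rule tendsto_sandwich[OF _ _ tendsto_const])
  define c :: real where "c = fact (k - 1)"
  \<comment> \<open>Chosen so that \<open>1 - 2 * \<delta> = 1 / (1 + \<epsilon>)\<close>. The
    factor \<open>(1 + \<epsilon>)\<^sup>2\<close> from \<open>p\<^sup>2\<close> can then lose
    \<open>1 - \<delta>\<close> twice and keep \<open>1 + \<epsilon>\<close>, the exponent needed to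
    sum over all sets.\<close>
  define \<delta> where "\<delta> = \<epsilon> / (2 * (1 + \<epsilon>))"
  define \<eta> where "\<eta> = \<delta> / 2"
  \<comment> \<open>The boundary between small and large sets. For
    \<open>card A \<le> \<gamma> * n\<close> and \<open>k \<le> \<gamma> * n\<close>, Bernoulli's
    inequality shows that restricting to edges outside \<open>A\<close> costs at most a factor
    \<open>1 - \<delta>\<close>.\<close>
  define \<gamma> where "\<gamma> = \<delta> / (2 * k)"
  define c1 where "c1 = \<eta> ^ 3 / 2"
  define c3 where "c3 = \<gamma> / (2 * 4 ^ k)"
  have c: "c > 0" unfolding c_def by simp
  have d: "0 < \<delta>" "\<delta> \<le> 1 / 2" "(1 - 2 * \<delta>) * (1 + \<epsilon>) = 1"
    using e by (auto simp: \<delta>_def field_simps)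
  have et: "0 < \<eta>" "\<eta> \<le> 1" "2 * \<eta> = \<delta>" using d by (auto simp: \<eta>_def)
  have g: "0 < \<gamma>" "2 * \<gamma> * k = \<delta>" using d k by (auto simp: \<gamma>_def)
  have g1: "2 * \<gamma> \<le> 1"
  proof -
    have "2 * \<gamma> * 1 \<le> 2 * \<gamma> * k" using g k by (intro mult_left_mono) auto
    then show ?thesis using g d by simp
  qed
  have cs: "c1 > 0" "c3 > 0" using et g by (auto simp: c1_def c3_def)
  \<comment> \<open>In this order: many overlapping pairs, few edges outside a set, small cuts,
    large cuts.\<close>
  define b where "b n = (1 + \<epsilon>)\<^sup>2 * c / ln (real n) + (2 ^ n * exp (- (c1 * (real n * ln (real n) ^ 3))) +
      (exp (real n powr (- \<epsilon>)) - 1) + 2 ^ n * exp (- (c3 * (real n * ln (real n)))))" for n :: nat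
  show "b \<longlonglongrightarrow> 0" unfolding b_def
  proof (intro tendsto_add_zero)
    show "(\<lambda>n. (1 + \<epsilon>)\<^sup>2 * c / ln (real n)) \<longlonglongrightarrow> 0"
      by (intro real_tendsto_divide_at_top[OF tendsto_const]) real_asymp
    show "(\<lambda>n. 2 ^ n * exp (- (c1 * (real n * ln (real n) ^ 3)))) \<longlonglongrightarrow> 0" using cs by real_asymp
    show "(\<lambda>n. 2 ^ n * exp (- (c3 * (real n * ln (real n))))) \<longlonglongrightarrow> 0" using cs by real_asymp
    show "(\<lambda>n. exp (real n powr (- \<epsilon>)) - 1) \<longlonglongrightarrow> 0" using e by real_asymp
  qed
  have "(\<lambda>n. (1 + \<epsilon>) * trail_threshold k n) \<longlonglongrightarrow> (1 + \<epsilon>) * 0"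
    using k by (intro tendsto_intros tendsto_trail_threshold) auto
  then have small: "\<forall>\<^sub>F n in sequentially. p n < 1"
    unfolding p_def by (intro order_tendstoD(2)[where y = "(1 + \<epsilon>) * 0"]) auto
  have "(\<lambda>n. (1 + \<epsilon>) * (trail_threshold k n * (real n * (ln (real n))\<^sup>2))) \<longlonglongrightarrow> (1 + \<epsilon>) * 0"
    using k by (intro tendsto_intros tendsto_trail_threshold_times) auto
  then have small2: "\<forall>\<^sub>F n in sequentially. (1 + \<epsilon>) * (trail_threshold k n * (real n * (ln (real n))\<^sup>2)) < 1 / (k * 4 ^ k)"
    using k by (intro order_tendstoD(2)[where y = "(1 + \<epsilon>) * 0"]) auto
  have large: "\<forall>\<^sub>F n in sequentially. ln (real n) \<ge> 1 / \<eta>" "\<forall>\<^sub>F n in sequentially. \<gamma> * real n \<ge> k"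
    using g by real_asymp+
  show "\<forall>\<^sub>F n in sequentially. rprob (possible_edges k n) (p n)
      (\<lambda>H. \<exists>A\<in>{A. A \<subseteq> {1..n} \<and> A \<noteq> {} \<and> 2 * card A \<le> n}. \<forall>x\<in>A. \<forall>y\<in>{1..n} - A. \<not> adj H x y) \<le> b n"
    using small small2 large eventually_ge_at_top[of "4 * k"]
  proof eventually_elim
    case (elim n)
    define L where "L = ln (real n)"
    define \<A> where "\<A> = {A. A \<subseteq> {1..n} \<and> A \<noteq> {} \<and> 2 * card A \<le> n}"
    \<comment> \<open>Between the expected number of overlapping pairs, at most of order
      \<open>n * L\<close>, and the size of the shadow, at least \<open>n * L ^ 3\<close>.\<close>
    define M where "M = real n * L\<^sup>2"
    define r where "r = exp (- ((1 + \<epsilon>) * L))"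
    let ?p = "p n"
    have n: "n \<ge> 2" using elim k by linarith
    have L: "L > 0" "\<eta> * L \<ge> 1" using n elim et by (auto simp: L_def field_simps)
    have p: "0 < ?p" "?p \<le> 1" using trail_threshold_pos[OF n, of k] elim e by (auto simp: p_def)
    have pnL: "?p * (real n * L\<^sup>2) \<le> 1 / (k * 4 ^ k)" using elim by (simp add: p_def L_def mult.assoc)
    have nk: "real n ^ k * ?p\<^sup>2 = (1 + \<epsilon>)\<^sup>2 * (c * L)"
    proof -
      have "real n ^ k * ?p\<^sup>2 = (1 + \<epsilon>)\<^sup>2 * (real n ^ k * (trail_threshold k n)\<^sup>2)"
        unfolding p_def power_mult_distrib by (rule mult.left_commute)
      also have "real n ^ k * (trail_threshold k n)\<^sup>2 = c * L"
        using power_times_trail_threshold_sq[of n k] n by (simp add: c_def L_def)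
      finally show ?thesis .
    qed
    have kf: "fact k = real k * c" using k by (simp add: c_def fact_reduce)
    have M: "M > 0" using n L by (simp add: M_def)
    have fin\<A>: "finite \<A>" unfolding \<A>_def by (rule finite_subset[of _ "Pow {1..n}"]) auto
    have kNp: "y ^ k * ((1 + \<epsilon>)\<^sup>2 * L) \<le> k * real (n - a choose k) * ?p\<^sup>2"
      if "0 \<le> y" "y * n \<le> real (n - a) - real k" for y :: real and a
    proof -
      have "(y * n) ^ k \<le> fact k * real (n - a choose k)"
        using that by (intro real_power_le_fact_mult_binomial) auto
      then have "(y * n) ^ k * ?p\<^sup>2 \<le> fact k * real (n - a choose k) * ?p\<^sup>2"
        by (intro mult_right_mono) auto
      also have "(y * n) ^ k * ?p\<^sup>2 = y ^ k * (real n ^ k * ?p\<^sup>2)" by (simp only: power_mult_distrib mult.assoc)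
      also have "\<dots> = c * (y ^ k * ((1 + \<epsilon>)\<^sup>2 * L))" unfolding nk by (simp only: mult_ac)
      also have "fact k * real (n - a choose k) * ?p\<^sup>2 = c * (k * real (n - a choose k) * ?p\<^sup>2)"
        unfolding kf by (simp only: mult_ac)
      finally show ?thesis using c by simp
    qed
    have e1: "1 \<le> (1 + \<epsilon>)\<^sup>2" using e by (intro one_le_power) auto
    have terms: "exp (- (\<eta> ^ 3 / 2 * (real (n - card A choose k) * ?p))) +
        exp (- (?p * real (card A) * (real k * ((1 - \<eta>) * (real (n - card A choose k) * ?p)) - M)))
      \<le> exp (- (c1 * (real n * L ^ 3))) + (r ^ card A + exp (- (c3 * (real n * L))))" if "A \<in> \<A>" for A
    proof -
      define a where "a = card A"
      define N where "N = real (n - a choose k)"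
      have a: "2 * a \<le> n" using that by (simp add: \<A>_def a_def)
      have nak: "real (n - a) = real n - real a" using a by simp
      \<comment> \<open>At least \<open>n / 2\<close> vertices lie outside \<open>A\<close>, and
        \<open>k \<le> n / 4\<close>. This crude bound holds for all sets and is the only one used
        for the large ones.\<close>
      have "(1 / 4) ^ k * ((1 + \<epsilon>)\<^sup>2 * L) \<le> k * N * ?p\<^sup>2"
        unfolding N_def using a elim nak by (intro kNp) auto
      moreover have "1 * L \<le> (1 + \<epsilon>)\<^sup>2 * L" using e1 L by (intro mult_right_mono) auto
      then have "(1 / 4) ^ k * L \<le> (1 / 4) ^ k * ((1 + \<epsilon>)\<^sup>2 * L)" by (intro mult_left_mono) auto
      ultimately have w: "L / 4 ^ k \<le> k * N * ?p\<^sup>2" by (simp add: power_divide)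
      \<comment> \<open>Since \<open>N * ?p\<^sup>2\<close> is at least of order \<open>L\<close>
        while \<open>?p * n * L\<^sup>2\<close> is small, cancelling one \<open>?p\<close> shows
        that the mean number of edges exceeds \<open>n * L ^ 3\<close>, enough for the Chernoff
        error to survive \<open>2 ^ n\<close> sets.\<close>
      have Np: "real n * L ^ 3 \<le> N * ?p"
      proof -
        have "?p * (real n * L\<^sup>2) * L \<le> 1 / (k * 4 ^ k) * L" using pnL L by (intro mult_right_mono) auto
        also have "\<dots> \<le> N * ?p\<^sup>2" using w k by (simp add: field_simps)
        finally have "?p * (real n * L ^ 3) \<le> ?p * (N * ?p)"
          by (simp add: power2_eq_square power3_eq_cube mult_ac)
        then show ?thesis using p by simp
      qed
      have "c1 * (real n * L ^ 3) \<le> \<eta> ^ 3 / 2 * (N * ?p)"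
        unfolding c1_def using Np et by (intro mult_left_mono) auto
      then have 1: "exp (- (\<eta> ^ 3 / 2 * (N * ?p))) \<le> exp (- (c1 * (real n * L ^ 3)))" by simp
      have MN: "M \<le> \<eta> * (k * (N * ?p))"
      proof -
        have "M * 1 \<le> M * (\<eta> * L)" using L M by (intro mult_left_mono) auto
        also have "\<dots> = \<eta> * (real n * L ^ 3)" by (simp add: M_def power2_eq_square power3_eq_cube)
        also have "\<dots> \<le> \<eta> * (N * ?p)" using Np et by (intro mult_left_mono) auto
        also have "1 * (N * ?p) \<le> k * (N * ?p)"
          using k p by (intro mult_right_mono mult_nonneg_nonneg) (auto simp: N_def)
        then have "\<eta> * (N * ?p) \<le> \<eta> * (k * (N * ?p))" using et by (intro mult_left_mono) auto
        finally show ?thesis by simp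
      qed
      \<comment> \<open>The first loss of \<open>\<delta> = 2 * \<eta>\<close>: one
        \<open>\<eta>\<close> for the deviation of the number of edges, one for the overlaps
        \<open>M\<close>.\<close>
      have "(1 - \<delta>) * (k * (N * ?p)) \<le> real k * ((1 - \<eta>) * (N * ?p)) - M"
        using MN et(3) by (simp add: algebra_simps flip: et(3))
      then have "(?p * real a) * ((1 - \<delta>) * (k * (N * ?p))) \<le> (?p * real a) * (real k * ((1 - \<eta>) * (N * ?p)) - M)"
        using p by (intro mult_left_mono) auto
      moreover have "(?p * real a) * ((1 - \<delta>) * (k * (N * ?p))) = real a * ((1 - \<delta>) * (k * N * ?p\<^sup>2))"
        by (simp only: power2_eq_square mult_ac)
      ultimately have ex: "real a * ((1 - \<delta>) * (k * N * ?p\<^sup>2)) \<le> ?p * real a * (real k * ((1 - \<eta>) * (N * ?p)) - M)"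
        by simp
      have 2: "exp (- (?p * real a * (real k * ((1 - \<eta>) * (N * ?p)) - M))) \<le> r ^ a + exp (- (c3 * (real n * L)))"
      \<comment> \<open>Small sets need the full exponent \<open>1 + \<epsilon>\<close> per vertex
        against the number of sets of their size. For large sets any exponent of order
        \<open>n * L\<close> beats \<open>2 ^ n\<close>.\<close>
      proof (cases "real a \<le> \<gamma> * n")
        case True
        have "(1 - 2 * \<gamma>) * n \<le> real (n - a) - real k" using True elim nak by (simp add: algebra_simps)
        then have "(1 - 2 * \<gamma>) ^ k * ((1 + \<epsilon>)\<^sup>2 * L) \<le> k * N * ?p\<^sup>2"
          unfolding N_def using g1 by (intro kNp) auto
        moreover have "1 - \<delta> \<le> (1 - 2 * \<gamma>) ^ k"
          using Bernoulli_inequality[of "- 2 * \<gamma>" k] g g1 by (simp add: mult_ac)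
        then have "(1 - \<delta>) * ((1 + \<epsilon>)\<^sup>2 * L) \<le> (1 - 2 * \<gamma>) ^ k * ((1 + \<epsilon>)\<^sup>2 * L)"
          using L by (intro mult_right_mono) auto
        ultimately have "(1 - \<delta>) * ((1 + \<epsilon>)\<^sup>2 * L) \<le> k * N * ?p\<^sup>2" by linarith
        then have q: "(1 - \<delta>) * ((1 - \<delta>) * ((1 + \<epsilon>)\<^sup>2 * L)) \<le> (1 - \<delta>) * (k * N * ?p\<^sup>2)"
          using d by (intro mult_left_mono) auto
        have "(1 - 2 * \<delta>) * ((1 + \<epsilon>)\<^sup>2 * L) \<le> (1 - \<delta>)\<^sup>2 * ((1 + \<epsilon>)\<^sup>2 * L)"
        proof (intro mult_right_mono)
          show "1 - 2 * \<delta> \<le> (1 - \<delta>)\<^sup>2" by (simp add: power2_eq_square algebra_simps)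
        qed (use L in auto)
        also have "(1 - 2 * \<delta>) * ((1 + \<epsilon>)\<^sup>2 * L) = ((1 - 2 * \<delta>) * (1 + \<epsilon>)) * ((1 + \<epsilon>) * L)"
          by (simp only: power2_eq_square mult_ac)
        also have "\<dots> = (1 + \<epsilon>) * L" unfolding d(3) by simp
        also have "(1 - \<delta>)\<^sup>2 * ((1 + \<epsilon>)\<^sup>2 * L) = (1 - \<delta>) * ((1 - \<delta>) * ((1 + \<epsilon>)\<^sup>2 * L))"
          by (simp only: power2_eq_square mult_ac)
        finally have "(1 + \<epsilon>) * L \<le> (1 - \<delta>) * (k * N * ?p\<^sup>2)" using q by linarith
        then have "real a * ((1 + \<epsilon>) * L) \<le> real a * ((1 - \<delta>) * (k * N * ?p\<^sup>2))" by (intro mult_left_mono) auto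
        then have "exp (- (?p * real a * (real k * ((1 - \<eta>) * (N * ?p)) - M))) \<le> exp (- (real a * ((1 + \<epsilon>) * L)))"
          using ex by simp
        also have "\<dots> = r ^ a" unfolding r_def exp_of_nat_mult[symmetric] by simp
        finally show ?thesis by (simp add: add_increasing2)
      next
        case False
        have h: "1 / 2 * (L / 4 ^ k) \<le> (1 - \<delta>) * (k * N * ?p\<^sup>2)"
          by (rule mult_mono) (use d w L in auto)
        have "(\<gamma> * n) * (1 / 2 * (L / 4 ^ k)) \<le> real a * ((1 - \<delta>) * (k * N * ?p\<^sup>2))"
          by (rule mult_mono[OF _ h]) (use False L in auto)
        also have "(\<gamma> * n) * (1 / 2 * (L / 4 ^ k)) = c3 * (real n * L)" by (simp add: c3_def)
        finally have "exp (- (?p * real a * (real k * ((1 - \<eta>) * (N * ?p)) - M))) \<le> exp (- (c3 * (real n * L)))"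
          using ex by simp
        moreover have "0 \<le> r ^ a" by (simp add: r_def)
        ultimately show ?thesis by linarith
      qed
      show ?thesis using add_mono[OF 1 2] unfolding N_def a_def .
    qed
    have sub: "\<A> \<subseteq> Pow {1..n} - {{}}" by (auto simp: \<A>_def)
    have "rprob (possible_edges k n) ?p (\<lambda>H. \<exists>A\<in>\<A>. \<forall>x\<in>A. \<forall>y\<in>{1..n} - A. \<not> adj H x y)
      \<le> real n ^ (k + 1) * ?p\<^sup>2 / M +
        (\<Sum>A\<in>\<A>. exp (- (\<eta> ^ 3 / 2 * (real (n - card A choose k) * ?p))) +
           exp (- (?p * real (card A) * (real k * ((1 - \<eta>) * (real (n - card A choose k) * ?p)) - M))))"
      unfolding \<A>_def using k p M et by (intro rprob_cut_le) auto
    also have "\<dots> \<le> (1 + \<epsilon>)\<^sup>2 * c / L + (2 ^ n * exp (- (c1 * (real n * L ^ 3))) +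
      (exp (real n powr (- \<epsilon>)) - 1) + 2 ^ n * exp (- (c3 * (real n * L))))"
    proof (intro add_mono)
      have "real n ^ (k + 1) * ?p\<^sup>2 / M = real n * (real n ^ k * ?p\<^sup>2) / M" by simp
      also have "\<dots> = (1 + \<epsilon>)\<^sup>2 * c / L" unfolding nk M_def using n L by (simp add: power2_eq_square)
      finally show "real n ^ (k + 1) * ?p\<^sup>2 / M \<le> (1 + \<epsilon>)\<^sup>2 * c / L" by simp
      have "(\<Sum>A\<in>\<A>. exp (- (\<eta> ^ 3 / 2 * (real (n - card A choose k) * ?p))) +
           exp (- (?p * real (card A) * (real k * ((1 - \<eta>) * (real (n - card A choose k) * ?p)) - M))))
        \<le> (\<Sum>A\<in>\<A>. exp (- (c1 * (real n * L ^ 3))) + (r ^ card A + exp (- (c3 * (real n * L)))))"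
        by (intro sum_mono terms)
      also have "\<dots> \<le> (\<Sum>A\<in>Pow {1..n} - {{}}. exp (- (c1 * (real n * L ^ 3))) + (r ^ card A + exp (- (c3 * (real n * L)))))"
        by (intro sum_mono2 sub) (auto simp: r_def)
      also have "\<dots> = real (card (Pow {1..n} - {{}})) * exp (- (c1 * (real n * L ^ 3))) +
          ((\<Sum>A\<in>Pow {1..n} - {{}}. r ^ card A) + real (card (Pow {1..n} - {{}})) * exp (- (c3 * (real n * L))))"
        by (simp only: sum.distrib sum_constant)
      also have "\<dots> \<le> 2 ^ n * exp (- (c1 * (real n * L ^ 3))) +
          ((exp (real n powr (- \<epsilon>)) - 1) + 2 ^ n * exp (- (c3 * (real n * L))))"
      proof (intro add_mono mult_right_mono)
        have "card (Pow {1..n} - {{}}) \<le> card (Pow {1..n})" by (intro card_mono) auto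
        also have "\<dots> = 2 ^ n" by (simp add: card_Pow)
        finally show "real (card (Pow {1..n} - {{}})) \<le> 2 ^ n" "real (card (Pow {1..n} - {{}})) \<le> 2 ^ n"
          by (metis of_nat_mono of_nat_numeral of_nat_power)+
        \<comment> \<open>Removing the empty set subtracts the 1, so the sum is about
          \<open>n * r\<close>, which is \<open>n powr (- \<epsilon>)\<close>.\<close>
        have "(\<Sum>A\<in>Pow {1..n} - {{}}. r ^ card A) = (\<Sum>A\<in>Pow {1..n}. r ^ card A) - 1"
          by (simp add: sum_diff1)
        also have "\<dots> = (1 + r) ^ n - 1" by (subst sum_power_card_Pow) auto
        also have "(1 + r) ^ n \<le> exp r ^ n" by (intro power_mono exp_ge_add_one_self) (simp add: r_def)
        also have "exp r ^ n = exp (real n * r)" by (simp add: exp_of_nat_mult)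
        also have "real n * r = exp L * r" using n by (simp add: L_def)
        also have "\<dots> = exp (- (\<epsilon> * L))" unfolding r_def exp_add[symmetric] by (simp add: algebra_simps)
        also have "\<dots> = real n powr (- \<epsilon>)" using n by (simp add: powr_def L_def)
        finally show "(\<Sum>A\<in>Pow {1..n} - {{}}. r ^ card A) \<le> exp (real n powr (- \<epsilon>)) - 1" by simp
      qed auto
      finally show "(\<Sum>A\<in>\<A>. exp (- (\<eta> ^ 3 / 2 * (real (n - card A choose k) * ?p))) +
           exp (- (?p * real (card A) * (real k * ((1 - \<eta>) * (real (n - card A choose k) * ?p)) - M))))
        \<le> 2 ^ n * exp (- (c1 * (real n * L ^ 3))) +
           (exp (real n powr (- \<epsilon>)) - 1) + 2 ^ n * exp (- (c3 * (real n * L)))" by simp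
    qed
    finally show ?case unfolding b_def L_def \<A>_def .
  qed
qed auto

lemma rprob_bad_config_tendsto_0:
  fixes k :: nat and \<epsilon> :: real
  assumes k: "k \<ge> 3" and e: "0 < \<epsilon>"
  defines "p \<equiv> \<lambda>n. (1 + \<epsilon>) * trail_threshold k n"
  shows "(\<lambda>n. rprob (possible_edges k n) (p n)
      (\<lambda>H. \<exists>(u, x, v, S, S')\<in>bad_configs k n.
        {insert u S, insert x S, insert x S', insert v S'} \<subseteq> H \<and> \<not> detour H x ({u, x, v} \<union> S \<union> S'))) \<longlonglongrightarrow> 0"
proof (rule tendsto_sandwich[OF _ _ tendsto_const])
  define c :: real where "c = fact (k - 1)"
  define C where "C = (1 + \<epsilon>)\<^sup>2 * c"
  \<comment> \<open>The factors come from \<open>h \<ge> n / 4\<close>, from bounding the binomial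
    coefficient below by \<open>(h / k) ^ (k - 2)\<close>, and from squaring
    \<open>h * p / 2\<close>.\<close>
  define c1 where "c1 = c / (4 * (4 * k) ^ k)"
  have c: "c > 0" unfolding c_def by simp
  have c1: "c1 > 0" unfolding c1_def using c k by simp
  have C: "C > 0" unfolding C_def using c e by simp
  define b where "b n = k * C * ((1 + \<epsilon>) * (trail_threshold k n * (real n * (ln (real n))\<^sup>2))) +
      k * (C * ln (real n))\<^sup>2 * real n powr (- c1)" for n :: nat
  have lim: "(\<lambda>n. (1 + \<epsilon>) * (trail_threshold k n * (real n * (ln (real n))\<^sup>2))) \<longlonglongrightarrow> 0"
    by (intro tendsto_mult_right_zero tendsto_trail_threshold_times k)
  show "b \<longlonglongrightarrow> 0" unfolding b_def
  proof (intro tendsto_add_zero)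
    show "(\<lambda>n. k * C * ((1 + \<epsilon>) * (trail_threshold k n * (real n * (ln (real n))\<^sup>2)))) \<longlonglongrightarrow> 0"
      by (intro tendsto_mult_right_zero[OF lim])
    have "(\<lambda>n. (C * ln (real n))\<^sup>2 * real n powr (- c1)) \<longlonglongrightarrow> 0" using c1 C by real_asymp
    from tendsto_mult_right_zero[OF this, of "real k"]
    show "(\<lambda>n. k * (C * ln (real n))\<^sup>2 * real n powr (- c1)) \<longlonglongrightarrow> 0" by (simp only: mult.assoc)
  qed
  have small: "\<forall>\<^sub>F n in sequentially. (1 + \<epsilon>) * (trail_threshold k n * (real n * (ln (real n))\<^sup>2)) < 1"
    by (intro order_tendstoD(2)[OF lim]) auto
  have large: "\<forall>\<^sub>F n in sequentially. ln (real n) \<ge> 1" by real_asymp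
  show "\<forall>\<^sub>F n in sequentially. rprob (possible_edges k n) (p n)
      (\<lambda>H. \<exists>(u, x, v, S, S')\<in>bad_configs k n.
        {insert u S, insert x S, insert x S', insert v S'} \<subseteq> H \<and> \<not> detour H x ({u, x, v} \<union> S \<union> S')) \<le> b n"
    using small large eventually_ge_at_top[of "16 * k + 12"]
  proof eventually_elim
    case (elim n)
    define L where "L = ln (real n)"
    \<comment> \<open>At most \<open>4 * k\<close> vertices belong to a configuration; the others
      are divided into three blocks.\<close>
    define h where "h = (n - 4 * k) div 3"
    let ?p = "p n"
    have n: "n \<ge> 2" using elim k by linarith
    have L: "L \<ge> 1" using elim by (simp add: L_def)
    have p0: "0 < ?p" using trail_threshold_pos[OF n, of k] e by (auto simp: p_def)
    have pnL: "?p * (real n * L\<^sup>2) < 1" using elim by (simp add: p_def L_def mult.assoc)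
    have L2: "L \<le> L\<^sup>2" "1 \<le> L\<^sup>2" using L by (auto simp: power2_eq_square mult_ge1_I)
    have np: "real n * ?p \<le> 1"
    proof -
      have "?p * real n * 1 \<le> ?p * real n * L\<^sup>2" using p0 L2 by (intro mult_left_mono) auto
      then show ?thesis using pnL by (simp add: mult_ac)
    qed
    have p1: "?p \<le> 1"
    proof -
      have "1 * ?p \<le> real n * ?p" using p0 n by (intro mult_right_mono) auto
      then show ?thesis using np by simp
    qed
    have nk: "real n ^ k * ?p\<^sup>2 = C * L"
    proof -
      have "real n ^ k * ?p\<^sup>2 = (1 + \<epsilon>)\<^sup>2 * (real n ^ k * (trail_threshold k n)\<^sup>2)"
        unfolding p_def power_mult_distrib by (rule mult.left_commute)
      also have "real n ^ k * (trail_threshold k n)\<^sup>2 = c * L"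
        using power_times_trail_threshold_sq[of n k] n by (simp add: c_def L_def)
      finally show ?thesis by (simp add: C_def)
    qed
    have h: "3 * h + 4 * k \<le> n" "real n / 4 \<le> real h" "k \<le> h" "h \<le> n" using elim unfolding h_def by linarith+
    have hp: "real h * ?p \<le> 1"
    proof -
      have "real h * ?p \<le> real n * ?p" using h p0 by (intro mult_right_mono) auto
      then show ?thesis using np by simp
    qed
    define q where "q = 1 - (1 - ?p) ^ h"
    \<comment> \<open>\<open>q\<close> is the chance that a given set extends to an edge by some
      vertex of a block. As \<open>h * ?p \<le> 1\<close>, it is linear in \<open>h * ?p\<close> up
      to a factor 2.\<close>
    have q: "real h * ?p / 2 \<le> q" "q \<le> 1"
    proof -
      have "(1 - ?p) ^ h \<le> exp (- ?p) ^ h"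
        using p1 exp_ge_add_one_self[of "- ?p"] by (intro power_mono) auto
      also have "\<dots> = exp (- (real h * ?p))" by (simp add: exp_of_nat_mult[symmetric])
      also have "\<dots> \<le> 1 / (1 + real h * ?p)"
        using p0 exp_ge_add_one_self[of "real h * ?p"] by (simp add: exp_minus field_simps add_pos_nonneg)
      also have "\<dots> \<le> 1 - real h * ?p / 2"
      proof -
        have "1 / (1 + y) \<le> 1 - y / 2" if "0 \<le> y" "y \<le> 1" for y :: real
        proof -
          have "0 \<le> y * (1 - y)" using that by simp
          then have "1 \<le> (1 - y / 2) * (1 + y)" by (simp add: algebra_simps)
          then show ?thesis using that by (simp add: pos_divide_le_eq)
        qed
        then show ?thesis using hp p0 by simp
      qed
      finally show "real h * ?p / 2 \<le> q" unfolding q_def by linarith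
      show "q \<le> 1" unfolding q_def using p1 by simp
    qed
    have q0: "0 \<le> q" using q(1) p0 by (intro order.trans[OF _ q(1)]) auto
    \<comment> \<open>The expected number of successful attempts is at least of order
      \<open>n^k * ?p\<^sup>2\<close>, hence of order \<open>L\<close>, so they all fail with at
      most a negative power of \<open>n\<close> as probability.\<close>
    have r: "(1 - q\<^sup>2) ^ (h choose (k - 2)) \<le> real n powr (- c1)"
    proof -
      let ?m = "real (h choose (k - 2))"
      have "(real h / k) ^ (k - 2) \<le> (real h / real (k - 2)) ^ (k - 2)"
        using k by (intro power_mono divide_left_mono) auto
      also have "\<dots> \<le> ?m" using binomial_ge_n_over_k_pow_k[of "k - 2" h, where 'a = real] h(3) by simp
      finally have m: "(real h / k) ^ (k - 2) \<le> ?m" .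
      have "(real n / (4 * k)) ^ k \<le> (real h / k) ^ k"
        using h(2) by (intro power_mono) (auto simp: divide_simps)
      also have "\<dots> = (real h / k)\<^sup>2 * (real h / k) ^ (k - 2)"
        unfolding power_add[symmetric] using k by (intro arg_cong[where f = "\<lambda>j. (real h / k) ^ j"]) simp
      also have "\<dots> \<le> (real h)\<^sup>2 * ?m"
      proof (rule mult_mono[OF _ m])
        have "real h / k \<le> real h / 1" using k by (intro divide_left_mono) auto
        then show "(real h / k)\<^sup>2 \<le> (real h)\<^sup>2" by (intro power_mono) auto
      qed auto
      finally have "(real n / (4 * k)) ^ k * (?p\<^sup>2 / 4) \<le> (real h)\<^sup>2 * ?m * (?p\<^sup>2 / 4)"
        by (intro mult_right_mono) auto
      also have "\<dots> = (real h * ?p / 2)\<^sup>2 * ?m" by (simp add: power_mult_distrib power_divide)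
      also have "\<dots> \<le> q\<^sup>2 * ?m" using q p0 by (intro mult_right_mono power_mono) auto
      also have "(real n / (4 * k)) ^ k * (?p\<^sup>2 / 4) = C * L / (4 * (4 * k) ^ k)"
        unfolding nk[symmetric] by (simp add: power_divide)
      finally have "C * L / (4 * (4 * k) ^ k) \<le> q\<^sup>2 * ?m" .
      moreover have "c1 * L \<le> C * L / (4 * (4 * k) ^ k)"
      proof -
        have "1 * c \<le> (1 + \<epsilon>)\<^sup>2 * c" using e c by (intro mult_right_mono one_le_power) auto
        then have "c * L \<le> C * L" using L unfolding C_def by (intro mult_right_mono) auto
        then have "c * L / (4 * (4 * k) ^ k) \<le> C * L / (4 * (4 * k) ^ k)" by (intro divide_right_mono) auto
        then show ?thesis by (simp add: c1_def)
      qed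
      ultimately have c1L: "c1 * L \<le> q\<^sup>2 * ?m" by linarith
      have "q\<^sup>2 \<le> 1" using q q0 by (intro power_le_one) auto
      then have "(1 - q\<^sup>2) ^ (h choose (k - 2)) \<le> exp (- q\<^sup>2) ^ (h choose (k - 2))"
        using exp_ge_add_one_self[of "- q\<^sup>2"] by (intro power_mono) auto
      also have "\<dots> = exp (- (q\<^sup>2 * ?m))" by (simp add: exp_of_nat_mult[symmetric] mult.commute)
      also have "\<dots> \<le> exp (- (c1 * L))" using c1L by simp
      also have "\<dots> = real n powr (- c1)" using n by (simp add: powr_def L_def)
      finally show ?thesis .
    qed
    have "rprob (possible_edges k n) (p n) (\<lambda>H. \<exists>(u, x, v, S, S')\<in>bad_configs k n.
        {insert u S, insert x S, insert x S', insert v S'} \<subseteq> H \<and> \<not> detour H x ({u, x, v} \<union> S \<union> S'))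
      \<le> k * real n ^ (k + 1) * ?p ^ 3 + k * real n ^ (2 * k) * (?p ^ 4 * (1 - q\<^sup>2) ^ (h choose (k - 2)))"
      unfolding q_def using k p0 p1 h by (intro rprob_bad_config_le) auto
    also have "\<dots> \<le> k * C * ((1 + \<epsilon>) * (trail_threshold k n * (real n * L\<^sup>2))) + k * (C * L)\<^sup>2 * real n powr (- c1)"
    proof (intro add_mono)
      \<comment> \<open>Three edges on \<open>k + 1\<close> free vertices contribute the logarithmic
        \<open>n^k * ?p\<^sup>2\<close> times an extra \<open>n * ?p\<close>, which tends to
        0.\<close>
      have "k * real n ^ (k + 1) * ?p ^ 3 = k * (real n * ?p) * (real n ^ k * ?p\<^sup>2)"
        by (simp add: power2_eq_square power3_eq_cube)
      also have "\<dots> = k * C * (?p * (real n * L))" unfolding nk by (simp only: mult_ac)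
      also have "\<dots> \<le> k * C * (?p * (real n * L\<^sup>2))"
        using C p0 L2 by (intro mult_left_mono) auto
      finally show "k * real n ^ (k + 1) * ?p ^ 3 \<le> k * C * ((1 + \<epsilon>) * (trail_threshold k n * (real n * L\<^sup>2)))"
        by (simp add: p_def mult.assoc)
      have "real n ^ (2 * k) * ?p ^ 4 = (real n ^ k * ?p\<^sup>2)\<^sup>2"
        by (simp add: power_mult_distrib power_mult[symmetric] mult.commute)
      then have "k * real n ^ (2 * k) * (?p ^ 4 * (1 - q\<^sup>2) ^ (h choose (k - 2))) =
          k * (C * L)\<^sup>2 * (1 - q\<^sup>2) ^ (h choose (k - 2))" unfolding nk by (metis mult.assoc)
      also have "\<dots> \<le> k * (C * L)\<^sup>2 * real n powr (- c1)" using r by (intro mult_left_mono) auto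
      finally show "k * real n ^ (2 * k) * (?p ^ 4 * (1 - q\<^sup>2) ^ (h choose (k - 2))) \<le> k * (C * L)\<^sup>2 * real n powr (- c1)" .
    qed
    finally show ?case unfolding b_def L_def .
  qed
qed auto

section \<open>Both sides of the threshold\<close>

lemma T_connected_if_no_cut_no_bad_config:
  assumes k: "k \<ge> 1" and H: "H \<subseteq> possible_edges k n"
    and cut: "\<not> (\<exists>A\<in>{A. A \<subseteq> {1..n} \<and> A \<noteq> {} \<and> 2 * card A \<le> n}. \<forall>x\<in>A. \<forall>y\<in>{1..n} - A. \<not> adj H x y)"
    and bad: "\<not> (\<exists>(u, x, v, S, S')\<in>bad_configs k n.
        {insert u S, insert x S, insert x S', insert v S'} \<subseteq> H \<and> \<not> detour H x ({u, x, v} \<union> S \<union> S'))"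
  shows "T_connected k {1..n} H"
proof (rule T_connectedI)
  have He: "e \<subseteq> {1..n} \<and> finite e \<and> card e = k" if "e \<in> H" for e
    using that H possible_edgesD[of e k n] by blast
  show "finite e \<and> card e = k" if "e \<in> H" for e using He[OF that] by simp
  show "k > 0" using k by simp
  show "(adj H)\<^sup>*\<^sup>* u v" if "u \<in> {1..n}" "v \<in> {1..n}" for u v
  proof (rule ccontr)
    assume "\<not> (adj H)\<^sup>*\<^sup>* u v"
    then have "\<not> (\<forall>u\<in>{1..n}. \<forall>v\<in>{1..n}. (adj H)\<^sup>*\<^sup>* u v)" using that by blast
    then have "\<exists>A. A \<subseteq> {1..n} \<and> A \<noteq> {} \<and> 2 * card A \<le> card {1..n} \<and> (\<forall>x\<in>A. \<forall>y\<in>{1..n} - A. \<not> adj H x y)"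
      by (rule not_connected_imp_cut[OF finite_atLeastAtMost]) (rule adj_sym)
    then show False using cut by simp
  qed
  fix u x v S S'
  assume *: "u \<noteq> x" "x \<noteq> v" "u \<noteq> v" "u \<notin> S" "x \<notin> S" "x \<notin> S'" "v \<notin> S'" "S \<noteq> S'" "S \<inter> S' \<noteq> {}"
    "insert u S \<in> H" "insert x S \<in> H" "insert x S' \<in> H" "insert v S' \<in> H"
  have "u \<in> {1..n}" "x \<in> {1..n}" "v \<in> {1..n}" "S \<subseteq> {1..n}" "S' \<subseteq> {1..n}" "card S = k - 1" "card S' = k - 1"
    using He[OF *(10)] He[OF *(12)] He[OF *(13)] *(4,6) by auto
  then have "(u, x, v, S, S') \<in> bad_configs k n" unfolding bad_configs_def using * by simp
  then have "detour H x ({u, x, v} \<union> S \<union> S')" using bad * by blast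
  then obtain T a b where T: "a \<noteq> b" "a \<notin> T" "b \<notin> T" "insert a T \<in> H" "insert b T \<in> H"
    "insert a T \<inter> ({u, x, v} \<union> S \<union> S') = {x}" "insert b T \<inter> ({u, x, v} \<union> S \<union> S') = {x}"
    unfolding detour_def by blast
  have "insert a T \<inter> insert x S = {x}" "insert b T \<inter> insert x S' = {x}" using T(6,7) by blast+
  then show "\<exists>T a b. a \<noteq> b \<and> a \<notin> T \<and> b \<notin> T \<and> insert a T \<in> H \<and> insert b T \<in> H \<and>
      insert a T \<inter> insert x S = {x} \<and> insert b T \<inter> insert x S' = {x}"
    using T(1-5) by blast
qed

lemma rprob_T_connected_tendsto_1:
  assumes k: "k \<ge> 3" and e: "0 < \<epsilon>" "\<epsilon> \<le> 1"
  shows "(\<lambda>n. rprob (possible_edges k n) ((1 + \<epsilon>) * trail_threshold k n) (T_connected k {1..n})) \<longlonglongrightarrow> 1"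
proof (rule tendsto_sandwich[OF _ _ _ tendsto_const])
  define p where "p n = (1 + \<epsilon>) * trail_threshold k n" for n
  define P where "P n = rprob (possible_edges k n) (p n)
      (\<lambda>H. \<exists>A\<in>{A. A \<subseteq> {1..n} \<and> A \<noteq> {} \<and> 2 * card A \<le> n}. \<forall>x\<in>A. \<forall>y\<in>{1..n} - A. \<not> adj H x y)" for n
  define Q where "Q n = rprob (possible_edges k n) (p n)
      (\<lambda>H. \<exists>(u, x, v, S, S')\<in>bad_configs k n.
        {insert u S, insert x S, insert x S', insert v S'} \<subseteq> H \<and> \<not> detour H x ({u, x, v} \<union> S \<union> S'))" for n
  have "P \<longlonglongrightarrow> 0" "Q \<longlonglongrightarrow> 0"
    unfolding P_def Q_def p_def
    by (rule rprob_cut_tendsto_0[OF k e], rule rprob_bad_config_tendsto_0[OF k e(1)])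
  then have "(\<lambda>n. 1 - (P n + Q n)) \<longlonglongrightarrow> 1 - (0 + 0)" by (intro tendsto_intros)
  then show "(\<lambda>n. 1 - (P n + Q n)) \<longlonglongrightarrow> 1" by simp
  have "1 - rprob (possible_edges k n) (p n) (T_connected k {1..n}) \<le> P n + Q n" for n
    unfolding P_def Q_def rprob_not[symmetric]
  proof (rule order.trans[OF rprob_mono rprob_Un_le])
    fix H assume "H \<subseteq> possible_edges k n" "\<not> T_connected k {1..n} H"
    moreover have "k \<ge> 1" using k by simp
    ultimately show "(\<exists>A\<in>{A. A \<subseteq> {1..n} \<and> A \<noteq> {} \<and> 2 * card A \<le> n}. \<forall>x\<in>A. \<forall>y\<in>{1..n} - A. \<not> adj H x y) \<or>
      (\<exists>(u, x, v, S, S')\<in>bad_configs k n.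
        {insert u S, insert x S, insert x S', insert v S'} \<subseteq> H \<and> \<not> detour H x ({u, x, v} \<union> S \<union> S'))"
      using T_connected_if_no_cut_no_bad_config[of k H n] by argo
  qed
  then show "\<forall>\<^sub>F n in sequentially. 1 - (P n + Q n) \<le>
      rprob (possible_edges k n) ((1 + \<epsilon>) * trail_threshold k n) (T_connected k {1..n})"
    unfolding p_def by (intro always_eventually allI) (simp add: algebra_simps)
qed auto

theorem theorem8:
  fixes k :: nat and \<epsilon> :: real and p :: "nat \<Rightarrow> real"
  assumes "k \<ge> 3" and "\<epsilon> > 0"
    and "\<And>n. 0 \<le> p n \<and> p n \<le> 1"
  shows "((\<forall>\<^sub>F n in sequentially.
             p n \<ge> (1 + \<epsilon>) * sqrt (fact (k - 1) * ln (real n) / real n ^ k)) \<longrightarrow>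
           (\<lambda>n. measure_pmf.prob (random_hypergraph k n (p n))
                  {H. T_connected k {1..n} H}) \<longlonglongrightarrow> 1) \<and>
         ((\<forall>\<^sub>F n in sequentially.
             p n \<le> (1 - \<epsilon>) * sqrt (fact (k - 1) * ln (real n) / real n ^ k)) \<longrightarrow>
           (\<lambda>n. measure_pmf.prob (random_hypergraph k n (p n))
                  {H. \<not> T_connected k {1..n} H}) \<longlonglongrightarrow> 1)"
  unfolding random_hypergraph_eq trail_threshold_def[symmetric]
proof (intro conjI impI)
  assume ge: "\<forall>\<^sub>F n in sequentially. (1 + \<epsilon>) * trail_threshold k n \<le> p n"
  \<comment> \<open>Lowering \<open>\<epsilon>\<close> only lowers the comparison probability, and
    trail connectedness is preserved when edges are added, so it suffices to treat a capped value at
    exactly \<open>(1 + \<epsilon>')\<close> times the threshold.\<close>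
  define \<epsilon>' where "\<epsilon>' = min \<epsilon> 1"
  have e: "0 < \<epsilon>'" "\<epsilon>' \<le> 1" "\<epsilon>' \<le> \<epsilon>" using assms(2) by (auto simp: \<epsilon>'_def)
  show "(\<lambda>n. rprob (possible_edges k n) (p n) (T_connected k {1..n})) \<longlonglongrightarrow> 1"
  proof (rule tendsto_sandwich[OF _ _ rprob_T_connected_tendsto_1[OF assms(1) e(1,2)] tendsto_const])
    show "\<forall>\<^sub>F n in sequentially.
        rprob (possible_edges k n) ((1 + \<epsilon>') * trail_threshold k n) (T_connected k {1..n})
        \<le> rprob (possible_edges k n) (p n) (T_connected k {1..n})"
      using ge
    proof eventually_elim
      case (elim n)
      have "(1 + \<epsilon>') * trail_threshold k n \<le> (1 + \<epsilon>) * trail_threshold k n"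
        using e by (intro mult_right_mono) auto
      then show ?case
        using elim e assms(3) by (intro rprob_mono_p) (auto intro: T_connected_mono)
    qed
  qed auto
next
  assume le: "\<forall>\<^sub>F n in sequentially. p n \<le> (1 - \<epsilon>) * trail_threshold k n"
  \<comment> \<open>The cap keeps \<open>1 - \<epsilon>'\<close> at least \<open>1 / 2\<close>; for
    \<open>\<epsilon> \<ge> 1\<close> the given bound would be no longer positive.\<close>
  define \<epsilon>' where "\<epsilon>' = min \<epsilon> (1 / 2)"
  have e: "0 < \<epsilon>'" "\<epsilon>' \<le> 1 / 2" "\<epsilon>' \<le> \<epsilon>" using assms(2) by (auto simp: \<epsilon>'_def)
  define P where "P n = rprob (possible_edges k n) (p n) (\<lambda>H. \<forall>u\<in>{1..n}. \<exists>y. adj H u y)" for n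
  have "\<forall>\<^sub>F n in sequentially. p n \<le> (1 - \<epsilon>') * trail_threshold k n"
    using le
  proof eventually_elim
    case (elim n)
    have "(1 - \<epsilon>) * trail_threshold k n \<le> (1 - \<epsilon>') * trail_threshold k n"
      using e by (intro mult_right_mono) auto
    with elim show ?case by linarith
  qed
  then have "P \<longlonglongrightarrow> 0"
    unfolding P_def using assms e by (intro rprob_no_isolated_tendsto_0[of k \<epsilon>']) auto
  then have lim: "(\<lambda>n. 1 - P n) \<longlonglongrightarrow> 1 - 0" by (intro tendsto_intros)
  show "(\<lambda>n. rprob (possible_edges k n) (p n) (\<lambda>H. \<not> T_connected k {1..n} H)) \<longlonglongrightarrow> 1"
  proof (rule tendsto_sandwich[OF _ _ lim[simplified] tendsto_const])
    show "\<forall>\<^sub>F n in sequentially. 1 - P n \<le> rprob (possible_edges k n) (p n) (\<lambda>H. \<not> T_connected k {1..n} H)"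
      using eventually_ge_at_top[of 2]
    proof eventually_elim
      case (elim n)
      have "rprob (possible_edges k n) (p n) (T_connected k {1..n}) \<le> P n"
        unfolding P_def
      proof (intro rprob_mono ballI)
        fix H u assume H: "H \<subseteq> possible_edges k n" "T_connected k {1..n} H" "u \<in> {1..n}"
        obtain v where v: "v \<in> {1..n}" "u \<noteq> v"
          using elim by (cases "u = 1") (auto intro: that[of 1] that[of 2])
        then obtain es where "one_offset_trail k H u v es"
          using H unfolding T_connected_def by blast
        moreover have "finite e \<and> card e = k" if "e \<in> H" for e
          using that H(1) possible_edgesD[of e k n] by blast
        ultimately show "\<exists>y. adj H u y" using assms(1) by (intro trail_imp_adj) auto
      qed
      then show ?case unfolding rprob_not by simp
    qed
  qed auto
qed

end
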